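(* Let $[S,T]\subseteq\mathbb{R}$ be an interval and let $m,n\in\mathbb{N}$. Let $p\in[1,3)$, let $\omega$ be a control function on $[S,T]$, and let $X=(X^\tau)_{\tau\in\mathcal{F}_n^2}$ be an $n$-dimensional branched rough path on $[S,T]$ with regularity $p$ and control $\omega$. Let $f$ be a compactly supported admissible rough velocity field on $\mathbb{R}^m$ with global coordinate representation $(f^i_\tau)$. Then for each $Y_0\in\mathbb{R}^m$ there exists a function $Y:[S,T]\to\mathbb{R}^m$ satisfying $Y(S)=Y_0$ for which there exists a constant $C\in(0,\infty)$ such that the inequality $$\left|Y^i(t)-Y^i(s)-\sum_{\tau\in\mathcal{F}_n^2}\frac{1}{\sigma(\tau)}f^i_\tau(Y(s))X^\tau(s,t)\right|\le C\,\omega(s,t)^{3/p}$$ holds for every $i\in\{1,\dots,m\}$ and every $S\le s\le t\le T$.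
   Context: Smooth means $C^\infty$; superscripts $i$ denote coordinates. For $I\subseteq\mathbb{R}$, $\Delta I:=\{(s,t)\in I^2: s\le t\}$. A control function on $[S,T]$ is a continuous function $\omega:\Delta[S,T]\to[0,\infty)$ with $\omega(s,s)=0$ for all $s$ and $\omega(s,t)\ge\omega(s,u)+\omega(u,t)$ for all $S\le s\le u\le t\le T$. $\mathcal{F}_n^2$ is the set of non-empty forests of rooted trees with at most two vertices, with vertices labeled by $\{1,\dots,n\}$. Its elements are: the one-vertex trees, written $\alpha$; the forests made of two one-vertex trees, written $\alpha\cdot\beta=\beta\cdot\alpha$ (unordered, $\alpha=\beta$ allowed; there are $n(n+1)/2$ of them); and the two-vertex trees, written $\alpha|\beta$ (top vertex $\alpha$, bottom vertex $\beta$; there are $n^2$ of them), with $\alpha,\beta\in\{1,\dots,n\}$. The symmetry factor is $\sigma(\alpha)=1$, $\sigma(\alpha|\beta)=1$, $\sigma(\alpha\cdot\beta)=1$ if $\alpha\ne\beta$, and $\sigma(\alpha\cdot\alpha)=2$. For $p\in[1,3)$, an $n$-dimensional branched rough path on $[S,T]$ with regularity $p$ and control $\omega$ is a tuple $X=(X^\tau)_{\tau\in\mathcal{F}_n^2}$ of functions $X^\tau:\Delta[S,T]\to\mathbb{R}$ such that for all $\alpha,\beta$ and all $S\le s\le u\le t\le T$: $X^\alpha(s,t)=X^\alpha(s,u)+X^\alpha(u,t)$; $X^{\alpha\cdot\beta}(s,t)=X^\alpha(s,t)X^\beta(s,t)$; $X^{\alpha|\beta}(s,t)=X^{\alpha|\beta}(s,u)+X^{\alpha|\beta}(u,t)+X^\alpha(s,u)X^\beta(u,t)$;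 and such that for some $C\in(0,\infty)$, $|X^\alpha(s,t)|\le C\omega(s,t)^{1/p}$, $|X^{\alpha\cdot\beta}(s,t)|\le C\omega(s,t)^{2/p}$, $|X^{\alpha|\beta}(s,t)|\le C\omega(s,t)^{2/p}$ for all $\alpha,\beta$ and $(s,t)\in\Delta[S,T]$. A rough velocity field on $\mathbb{R}^m$, identified with its coordinate representation in the global chart, is a tuple $f=(f^i_\tau)$ ($i\in\{1,\dots,m\}$, $\tau\in\mathcal{F}_n^2$) of smooth functions $f^i_\tau:\mathbb{R}^m\to\mathbb{R}$. It is compactly supported if the closure of the set of points at which some $f^i_\tau$ is non-zero is compact. It is admissible if $\sum_{j=1}^m\frac{\partial f^i_\beta}{\partial y^j}f^j_\alpha=f^i_{\alpha\cdot\beta}+f^i_{\alpha|\beta}$ on $\mathbb{R}^m$ for all $i\in\{1,\dots,m\}$ and $\alpha,\beta\in\{1,\dots,n\}$. *)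

theory Defs
  imports "HOL-Analysis.Analysis" "HOL-Library.Uprod"
begin

text \<open>
  Non-empty forests with at most two vertices, labelled by \<open>'n\<close>: \<open>Vertex a\<close> is the tree \<open>a\<close>,
  \<open>Vertices (Upair a b)\<close> is the forest \<open>a \<cdot> b\<close>, and \<open>Ladder a b\<close> is the tree \<open>a|b\<close>
  with top vertex \<open>a\<close> and root \<open>b\<close>.  The label set of size \<open>n\<close> is the finite type \<open>'n\<close>.
\<close>

datatype 'n forest = Vertex 'n | Vertices "'n uprod" | Ladder 'n 'n

instance forest :: (finite) finite
proof
  have "u \<in> range (case_prod Upair)" for u :: "'a uprod"
    by (cases u) auto
  then have "(UNIV :: 'a uprod set) = range (case_prod Upair)"
    by blast
  then have "finite (UNIV :: 'a uprod set)"
    by (metis finite finite_imageI)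
  moreover have "(UNIV :: 'a forest set) =
      range Vertex \<union> Vertices ` UNIV \<union> range (case_prod Ladder)"
    by (auto simp: image_iff) (metis forest.exhaust)
  ultimately show "finite (UNIV :: 'a forest set)"
    by (metis finite finite_UnI finite_imageI)
qed

fun symmetry_factor :: "'n forest \<Rightarrow> nat" where
  "symmetry_factor (Vertex a) = 1"
| "symmetry_factor (Vertices u) = (if \<exists>a. u = Upair a a then 2 else 1)"
| "symmetry_factor (Ladder a b) = 1"

definition ordered_times :: "real \<Rightarrow> real \<Rightarrow> (real \<times> real) set" where
  "ordered_times S T = {(s, t). S \<le> s \<and> s \<le> t \<and> t \<le> T}"

definition control_function :: "real \<Rightarrow> real \<Rightarrow> (real \<Rightarrow> real \<Rightarrow> real) \<Rightarrow> bool" where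
  "control_function S T \<omega> \<longleftrightarrow>
     continuous_on (ordered_times S T) (\<lambda>(s, t). \<omega> s t) \<and>
     (\<forall>(s, t) \<in> ordered_times S T. 0 \<le> \<omega> s t) \<and>
     (\<forall>s \<in> {S..T}. \<omega> s s = 0) \<and>
     (\<forall>s u t. S \<le> s \<and> s \<le> u \<and> u \<le> t \<and> t \<le> T \<longrightarrow> \<omega> s u + \<omega> u t \<le> \<omega> s t)"

definition branched_rough_path ::
  "real \<Rightarrow> real \<Rightarrow> real \<Rightarrow> (real \<Rightarrow> real \<Rightarrow> real) \<Rightarrow>
   ('n forest \<Rightarrow> real \<Rightarrow> real \<Rightarrow> real) \<Rightarrow> bool" where
  "branched_rough_path S T p \<omega> X \<longleftrightarrow>
     (\<forall>a b s u t. S \<le> s \<and> s \<le> u \<and> u \<le> t \<and> t \<le> T \<longrightarrow>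
        X (Vertex a) s t = X (Vertex a) s u + X (Vertex a) u t \<and>
        X (Vertices (Upair a b)) s t = X (Vertex a) s t * X (Vertex b) s t \<and>
        X (Ladder a b) s t =
          X (Ladder a b) s u + X (Ladder a b) u t + X (Vertex a) s u * X (Vertex b) u t) \<and>
     (\<exists>C>0. \<forall>a b. \<forall>(s, t) \<in> ordered_times S T.
        \<bar>X (Vertex a) s t\<bar> \<le> C * \<omega> s t powr (1 / p) \<and>
        \<bar>X (Vertices (Upair a b)) s t\<bar> \<le> C * \<omega> s t powr (2 / p) \<and>
        \<bar>X (Ladder a b) s t\<bar> \<le> C * \<omega> s t powr (2 / p))"

text \<open>\<open>C_k k g\<close>: the function \<open>g\<close> is \<open>k\<close> times continuously differentiable on the whole space.\<close>

fun C_k :: "nat \<Rightarrow> ('a::real_normed_vector \<Rightarrow> 'b::real_normed_vector) \<Rightarrow> bool" where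
  "C_k 0 g \<longleftrightarrow> continuous_on UNIV g"
| "C_k (Suc k) g \<longleftrightarrow>
     (\<forall>x. g differentiable (at x)) \<and> (\<forall>v. C_k k (\<lambda>x. frechet_derivative g (at x) v))"

definition smooth :: "('a::real_normed_vector \<Rightarrow> 'b::real_normed_vector) \<Rightarrow> bool" where
  "smooth g \<longleftrightarrow> (\<forall>k. C_k k g)"

definition partial_derivative :: "'m \<Rightarrow> (real ^ 'm \<Rightarrow> real) \<Rightarrow> real ^ 'm \<Rightarrow> real" where
  "partial_derivative j g y = frechet_derivative g (at y) (axis j 1)"

text \<open>In the following, \<open>f i \<tau>\<close> is the \<open>i\<close>-th coordinate of the vector field indexed by \<open>\<tau>\<close>.\<close>

definition rough_velocity_field :: "('m::finite \<Rightarrow> 'n forest \<Rightarrow> real ^ 'm \<Rightarrow> real) \<Rightarrow> bool" where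
  "rough_velocity_field f \<longleftrightarrow> (\<forall>i \<tau>. smooth (f i \<tau>))"

definition compactly_supported :: "('m::finite \<Rightarrow> 'n forest \<Rightarrow> real ^ 'm \<Rightarrow> real) \<Rightarrow> bool" where
  "compactly_supported f \<longleftrightarrow> compact (closure {y. \<exists>i \<tau>. f i \<tau> y \<noteq> 0})"

definition admissible :: "('m::finite \<Rightarrow> 'n forest \<Rightarrow> real ^ 'm \<Rightarrow> real) \<Rightarrow> bool" where
  "admissible f \<longleftrightarrow>
     (\<forall>i a b y. (\<Sum>j\<in>UNIV. partial_derivative j (f i (Vertex b)) y * f j (Vertex a) y) =
        f i (Vertices (Upair a b)) y + f i (Ladder a b) y)"

end

theory Submission imports Defs begin

text \<open>
  Let \<open>\<mu>\<^bsub>s,t\<^esub>(y)\<close> be one Euler step \<open>y + \<Sum>\<^sub>\<tau> f\<^sub>\<tau>(y) X\<^sup>\<tau>(s,t) / \<sigma>(\<tau>)\<close>.  Taylor expansion, Chen's relations and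
  admissibility show that \<open>\<mu>\<close> is an almost flow: \<open>\<mu>\<^bsub>u,t\<^esub> \<circ> \<mu>\<^bsub>s,u\<^esub> - \<mu>\<^bsub>s,t\<^esub>\<close> is of order \<open>\<omega>(s,t)\<close> to the
  power \<open>\<theta> = 3 / p > 1\<close>.  As \<open>2\<^sup>\<theta> > 2\<close>, bisecting with respect to \<open>\<omega>\<close> (Davie) shows that the Euler scheme
  on any finite set of times satisfies the required estimate between any two of its times with
  \<open>\<omega>(s,t) \<le> \<delta>\<close>, with a constant independent of the set.  Because \<open>f\<close> has compact support, all schemes stay
  in one ball, so by Tychonoff's theorem the estimates for all pairs of times hold simultaneously for
  some \<open>Y\<close>; no continuity of \<open>Y\<close> is needed.  For \<open>\<omega>(s,t) > \<delta>\<close> the estimate holds by boundedness.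
\<close>

section \<open>Functions of compact support\<close>

lemma bounded_if_zero_outside_compact:
  fixes g :: "'a::topological_space \<Rightarrow> real"
  assumes "continuous_on UNIV g" "compact K" "\<And>y. y \<notin> K \<Longrightarrow> g y = 0"
  shows "\<exists>M\<ge>0. \<forall>y. \<bar>g y\<bar> \<le> M"
proof -
  have "bounded (g ` K)"
    by (meson assms compact_continuous_image compact_imp_bounded continuous_on_subset subset_UNIV)
  then obtain M where M: "\<And>y. y \<in> K \<Longrightarrow> \<bar>g y\<bar> \<le> M"
    by (auto simp: bounded_iff)
  have "\<bar>g y\<bar> \<le> max M 0" for y
    using M assms(3)[of y] by (cases "y \<in> K") (auto simp: le_max_iff_disj)
  then show ?thesis
    by (metis max.cobounded2)
qed

lemma frechet_derivative_zero_outside_closed: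
  fixes g :: "'a::real_normed_vector \<Rightarrow> 'b::real_normed_vector"
  assumes "closed K" "\<And>y. y \<notin> K \<Longrightarrow> g y = 0" "y \<notin> K"
  shows "frechet_derivative g (at y) = (\<lambda>v. 0)"
proof -
  have "(g has_derivative (\<lambda>v. 0)) (at y)"
    by (rule has_derivative_transform_within_open[of "\<lambda>_. 0" _ _ _ "- K"])
      (use assms in auto)
  then show ?thesis
    by (metis frechet_derivative_at)
qed

text \<open>\<open>C_k\<close> controls derivatives only in one fixed direction at a time, while the
  mean value inequality needs an operator norm. Expanding the argument in the basis and adding up
  the bounds provides one.\<close>

lemma linear_bound_Basis:
  fixes L :: "'a::euclidean_space \<Rightarrow> real"
  assumes "linear L" "\<And>b. b \<in> Basis \<Longrightarrow> \<bar>L b\<bar> \<le> c b"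
  shows "\<bar>L v\<bar> \<le> (\<Sum>b\<in>Basis. c b) * norm v"
proof -
  have "L v = L (\<Sum>b\<in>Basis. (v \<bullet> b) *\<^sub>R b)"
    by (simp add: euclidean_representation)
  also have "\<dots> = (\<Sum>b\<in>Basis. (v \<bullet> b) * L b)"
    using assms(1) by (simp add: linear_sum linear_cmul)
  also have "\<bar>\<dots>\<bar> \<le> (\<Sum>b\<in>Basis. \<bar>(v \<bullet> b) * L b\<bar>)"
    by (rule sum_abs)
  also have "\<dots> \<le> (\<Sum>b\<in>Basis. norm v * c b)"
    using assms(2) by (intro sum_mono) (auto simp: abs_mult Basis_le_norm intro!: mult_mono)
  finally show ?thesis
    by (simp add: sum_distrib_left mult.commute)
qed

text \<open>Each basis directional derivative is continuous and vanishes off \<open>K\<close>, hence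
  is bounded; the operator norm is then bounded uniformly and the mean value inequality
  applies.\<close>

lemma C_1_compact_support_Lipschitz:
  fixes g :: "'a::euclidean_space \<Rightarrow> real"
  assumes "C_k 1 g" "compact K" "\<And>y. y \<notin> K \<Longrightarrow> g y = 0"
  shows "\<exists>L\<ge>0. \<forall>y z. \<bar>g z - g y\<bar> \<le> L * norm (z - y)"
proof -
  let ?D = "\<lambda>y. frechet_derivative g (at y)"
  have D: "(g has_derivative ?D y) (at y)" for y
    using assms(1) by (simp add: frechet_derivative_works[symmetric])
  have "\<exists>M\<ge>0. \<forall>y. \<bar>?D y b\<bar> \<le> M" for b
  proof (rule bounded_if_zero_outside_compact[OF _ assms(2)])
    show "continuous_on UNIV (\<lambda>y. ?D y b)"
      using assms(1) by simp
    show "?D y b = 0" if "y \<notin> K" for y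
      by (subst frechet_derivative_zero_outside_closed[of K])
        (use assms that compact_imp_closed in auto)
  qed
  then obtain M where M: "\<And>b. M b \<ge> 0" "\<And>b y. \<bar>?D y b\<bar> \<le> M b"
    by metis
  define L where "L = (\<Sum>b\<in>Basis. M b)"
  have "onorm (?D y) \<le> L" for y
  proof (rule onorm_le)
    show "norm (?D y v) \<le> L * norm v" for v
      unfolding L_def real_norm_def using M(2)
      by (intro linear_bound_Basis) (auto intro: has_derivative_linear[OF D])
  qed
  then have "norm (g z - g y) \<le> L * norm (z - y)" for y z
    using D by (intro differentiable_bound[of UNIV g ?D]) auto
  moreover have "L \<ge> 0"
    unfolding L_def using M(1) by (simp add: sum_nonneg)
  ultimately show ?thesis
    by auto
qed

text \<open>The preceding lemma, applied to every basis directional derivative, makes the derivative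
  itself Lipschitz in operator norm; integrating this along the segment gives a quadratic
  remainder.\<close>

lemma C_2_compact_support_Taylor:
  fixes g :: "'a::euclidean_space \<Rightarrow> real"
  assumes "C_k 2 g" "compact K" "\<And>y. y \<notin> K \<Longrightarrow> g y = 0"
  shows "\<exists>L\<ge>0. \<forall>y z. \<bar>g z - g y - frechet_derivative g (at y) (z - y)\<bar> \<le> L * (norm (z - y))\<^sup>2"
proof -
  let ?D = "\<lambda>y. frechet_derivative g (at y)"
  have diff: "g differentiable (at y)" and C_1: "C_k 1 (\<lambda>y. ?D y v)" for y v
    using assms(1) unfolding numeral_2_eq_2 One_nat_def by simp_all
  then have D: "(g has_derivative ?D y) (at y)" for y
    by (simp add: frechet_derivative_works[symmetric])
  have "\<exists>L\<ge>0. \<forall>y z. \<bar>?D z b - ?D y b\<bar> \<le> L * norm (z - y)" for b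
  proof (rule C_1_compact_support_Lipschitz[OF C_1 assms(2)])
    show "?D y b = 0" if "y \<notin> K" for y
      by (subst frechet_derivative_zero_outside_closed[of K])
        (use assms that compact_imp_closed in auto)
  qed
  then obtain M where M: "\<And>b. M b \<ge> 0" "\<And>b y z. \<bar>?D z b - ?D y b\<bar> \<le> M b * norm (z - y)"
    by metis
  define L where "L = (\<Sum>b\<in>Basis. M b)"
  have L0: "L \<ge> 0"
    unfolding L_def using M(1) by (simp add: sum_nonneg)
  \<comment> \<open>One factor \<open>norm (z - y)\<close> is the length of the segment, the other
    comes from the variation of the derivative along it.\<close>
  have "norm (g z - g y - ?D y (z - y)) \<le> norm (z - y) * (L * norm (z - y))" for y z
  proof (rule differentiable_bound_linearization[of _ _ "closed_segment y z"])
    show "y + t *\<^sub>R (z - y) \<in> closed_segment y z" if "t \<in> {0..1}" for t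
      using that by (auto simp: in_segment algebra_simps intro!: exI[of _ t])
    show "(g has_derivative ?D x) (at x within closed_segment y z)" for x
      using D has_derivative_at_withinI by blast
    show "onorm (?D x - ?D y) \<le> L * norm (z - y)" if "x \<in> closed_segment y z" for x
    proof (rule onorm_le)
      fix v
      have lin: "linear (?D x - ?D y)"
        using has_derivative_linear[OF D] by (simp add: linear_compose_sub fun_diff_def)
      have "norm ((?D x - ?D y) v) \<le> (\<Sum>b\<in>Basis. M b * norm (x - y)) * norm v"
        unfolding real_norm_def by (rule linear_bound_Basis[OF lin]) (use M(2) in auto)
      also have "\<dots> = L * norm (x - y) * norm v"
        by (simp add: L_def sum_distrib_right)
      also have "\<dots> \<le> L * norm (z - y) * norm v"
        using L0 segment_bound(1)[OF that] by (intro mult_right_mono mult_left_mono) auto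
      finally show "norm ((?D x - ?D y) v) \<le> L * norm (z - y) * norm v" .
    qed
  qed auto
  then show ?thesis
    using L0 by (intro exI[of _ L]) (auto simp: power2_eq_square mult_ac)
qed

section \<open>Solutions of almost flows\<close>

text \<open>The set is a parameter because the property is used both on the whole interval and on
  finite sets of times.\<close>

definition superadditive_on :: "real set \<Rightarrow> (real \<Rightarrow> real \<Rightarrow> real) \<Rightarrow> bool" where
  "superadditive_on I \<omega> \<longleftrightarrow>
     (\<forall>s\<in>I. \<forall>u\<in>I. \<forall>t\<in>I. s \<le> u \<and> u \<le> t \<longrightarrow> \<omega> s u + \<omega> u t \<le> \<omega> s t)"

text \<open>Times are added in increasing order, and each new value is one step away from the last
  time so far. The condition on \<open>u\<close> says that \<open>s\<close> and \<open>t\<close> are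
  consecutive. \<open>Y\<close> is a total function with all values in \<open>B\<close>, so that it
  is a point of the product space to which Tychonoff's theorem is applied later.\<close>

lemma exists_Euler_scheme:
  fixes \<mu> :: "real \<Rightarrow> real \<Rightarrow> 'a \<Rightarrow> 'a"
  assumes "finite D" "\<forall>t\<in>D. S < t" "\<And>s t y. y \<in> B \<Longrightarrow> \<mu> s t y \<in> B" "y0 \<in> B"
  shows "\<exists>Y. Y S = y0 \<and> (\<forall>t. Y t \<in> B) \<and>
    (\<forall>s\<in>insert S D. \<forall>t\<in>D. s < t \<and> (\<forall>u\<in>D. u \<le> s \<or> t \<le> u) \<longrightarrow> Y t = \<mu> s t (Y s))"
  using assms(1,2)
proof (induction D rule: finite_linorder_max_induct)
  case empty
  show ?case
    using assms(4) by (intro exI[of _ "\<lambda>_. y0"]) auto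
next
  case (insert b D)
  then have "\<forall>t\<in>D. S < t"
    by simp
  from insert.IH[OF this] obtain Y where Y: "Y S = y0" "\<And>t. Y t \<in> B"
    "\<And>s t. \<lbrakk>s \<in> insert S D; t \<in> D; s < t; \<forall>u\<in>D. u \<le> s \<or> t \<le> u\<rbrakk> \<Longrightarrow> Y t = \<mu> s t (Y s)"
    by blast
  \<comment> \<open>\<open>m\<close> is the predecessor of the new time \<open>b\<close>; the only
    pair of consecutive times ending in \<open>b\<close> is \<open>m\<close>,
    \<open>b\<close>.\<close>
  define m where "m = Max (insert S D)"
  have m: "m \<in> insert S D" "\<And>u. u \<in> insert S D \<Longrightarrow> u \<le> m"
    unfolding m_def using insert.hyps(1) by (auto intro: Max_in[of "insert S D"] simp del: Max_insert insert_iff)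
  have mb: "m < b"
    using m(1) insert.hyps(2) insert.prems by auto
  have Sb: "S < b"
    using insert.prems by auto
  let ?Y = "Y(b := \<mu> m b (Y m))"
  have "?Y t = \<mu> s t (?Y s)"
    if st: "s \<in> insert S (insert b D)" "t \<in> insert b D" "s < t"
      "\<forall>u\<in>insert b D. u \<le> s \<or> t \<le> u" for s t
  proof (cases "t = b")
    case True
    have "s \<in> insert S D"
      using st True by auto
    moreover have "m \<le> s"
      using m(1) st(1,4) True mb insert.prems by force
    ultimately have "s = m"
      using m(2) by force
    then show ?thesis
      using True mb by simp
  next
    case False
    then have "t \<in> D" "t < b"
      using st insert.hyps by auto
    then show ?thesis
      using st by (auto intro!: Y(3))
  qed
  then show ?case
    using Y(1,2) Sb assms(3) by (intro exI[of _ ?Y]) auto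
qed

text \<open>Induction on the number of times in \<open>[s, t]\<close>; between consecutive times the
  error is zero. Otherwise a consecutive pair \<open>m\<close>, \<open>m'\<close> is found such that
  both \<open>[s, m]\<close> and \<open>[m', t]\<close> carry at most half of the control. The error
  on \<open>[m', t]\<close> enters once, the one on \<open>[s, m]\<close> is carried on by a step
  and enters with the factor \<open>\<Lambda>\<close>, and the almost flow property is used twice.
  The constant closes because \<open>1 + \<Lambda> < 2 powr \<theta>\<close>.\<close>

lemma Euler_scheme_estimate:
  fixes \<mu> :: "real \<Rightarrow> real \<Rightarrow> 'a::real_normed_vector \<Rightarrow> 'a"
  assumes "finite D"
    and nonneg: "\<And>s t. \<lbrakk>s \<in> D; t \<in> D; s \<le> t\<rbrakk> \<Longrightarrow> 0 \<le> \<omega> s t"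
    and zero: "\<And>s. s \<in> D \<Longrightarrow> \<omega> s s = 0"
    and super: "superadditive_on D \<omega>"
    and id: "\<And>s y. s \<in> D \<Longrightarrow> \<mu> s s y = y"
    and lip: "\<And>s t y z. \<lbrakk>s \<in> D; t \<in> D; s \<le> t; \<omega> s t \<le> \<delta>\<rbrakk> \<Longrightarrow>
      norm (\<mu> s t z - \<mu> s t y) \<le> \<Lambda> * norm (z - y)"
    and almost: "\<And>s u t y. \<lbrakk>s \<in> D; u \<in> D; t \<in> D; s \<le> u; u \<le> t; \<omega> s t \<le> \<delta>\<rbrakk> \<Longrightarrow>
      norm (\<mu> u t (\<mu> s u y) - \<mu> s t y) \<le> K * \<omega> s t powr \<theta>"
    and "0 \<le> \<Lambda>" "0 \<le> K" "0 \<le> \<theta>" "1 + \<Lambda> < 2 powr \<theta>"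
    and step: "\<And>s t. \<lbrakk>s \<in> D; t \<in> D; s < t; \<forall>u\<in>D. u \<le> s \<or> t \<le> u\<rbrakk> \<Longrightarrow> Y t = \<mu> s t (Y s)"
    and C: "C = 2 * K / (1 - (1 + \<Lambda>) / 2 powr \<theta>)"
    and "s \<in> D" "t \<in> D" "s \<le> t" "\<omega> s t \<le> \<delta>"
  shows "norm (Y t - \<mu> s t (Y s)) \<le> C * \<omega> s t powr \<theta>"
  using \<open>s \<in> D\<close> \<open>t \<in> D\<close> \<open>s \<le> t\<close> \<open>\<omega> s t \<le> \<delta>\<close>
proof (induction "card (D \<inter> {s..t})" arbitrary: s t rule: less_induct)
  case less
  have pos: "0 < 1 - (1 + \<Lambda>) / 2 powr \<theta>"
    using \<open>1 + \<Lambda> < 2 powr \<theta>\<close> by simp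
  then have C0: "0 \<le> C"
    unfolding C using \<open>0 \<le> K\<close> by simp
  \<comment> \<open>\<open>C\<close> is chosen as the fixed point of the recursion for the constant:
    two halves with weights 1 and \<open>\<Lambda>\<close>, plus two defects of size
    \<open>K\<close>.\<close>
  have C_eq: "C * ((1 + \<Lambda>) / 2 powr \<theta>) + 2 * K = C"
    using pos unfolding C by (simp add: divide_simps) (simp add: algebra_simps)
  have w0: "0 \<le> \<omega> s t"
    using less nonneg by simp
  have add: "\<omega> a b + \<omega> b c \<le> \<omega> a c" if "a \<in> D" "b \<in> D" "c \<in> D" "a \<le> b" "b \<le> c" for a b c
    using super that unfolding superadditive_on_def by blast
  have sub: "\<omega> a b \<le> \<omega> s t" if "a \<in> D" "b \<in> D" "s \<le> a" "a \<le> b" "b \<le> t" for a b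
    using add[of s a t] add[of a b t] nonneg[of s a] nonneg[of b t] that less.prems by force
  consider "s = t" | "s < t" "\<forall>u\<in>D. u \<le> s \<or> t \<le> u" | "s < t" "\<exists>u\<in>D. s < u \<and> u < t"
    using less.prems by force
  then show ?case
  proof cases
    case 1
    then show ?thesis
      using id less.prems C0 by simp
  next
    case 2
    then show ?thesis
      using step less.prems C0 by simp
  next
    case 3
    \<comment> \<open>\<open>m\<close> is the last time before \<open>t\<close> at which at most
      half of the control has been used, and \<open>m'\<close> is its successor. Excluding
      \<open>t\<close> from \<open>E\<close> guarantees that the successor exists within
      \<open>[s, t]\<close>.\<close>
    define E where "E = {u \<in> D. s \<le> u \<and> u < t \<and> \<omega> s u \<le> \<omega> s t / 2}"
    define m where "m = Max E"
    have E: "finite E" "s \<in> E"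
      using \<open>finite D\<close> less.prems 3 w0 zero by (auto simp: E_def)
    then have "m \<in> E"
      unfolding m_def using Max_in by blast
    then have m: "m \<in> D" "s \<le> m" "m < t" "\<omega> s m \<le> \<omega> s t / 2"
      by (auto simp: E_def)
    define F where "F = {u \<in> D. m < u \<and> u \<le> t}"
    define m' where "m' = Min F"
    have F: "finite F" "t \<in> F"
      using \<open>finite D\<close> less.prems m by (auto simp: F_def)
    then have "m' \<in> F"
      unfolding m'_def using Min_in by blast
    then have m': "m' \<in> D" "m < m'" "m' \<le> t"
      by (auto simp: F_def)
    have adj: "\<forall>u\<in>D. u \<le> m \<or> m' \<le> u"
      using F m' unfolding m'_def F_def by (metis (mono_tags, lifting) Min_le linorder_le_less_linear mem_Collect_eq order.strict_implies_order order.trans)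
    have half: "\<omega> m' t \<le> \<omega> s t / 2"
    proof (cases "m' = t")
      case True
      then show ?thesis
        using zero less.prems w0 by simp
    next
      case False
      \<comment> \<open>By maximality of \<open>m\<close>, more than half of the control is used on
        \<open>[s, m']\<close>; superadditivity leaves less than half for
        \<open>[m', t]\<close>.\<close>
      have "m' \<notin> E"
        using E m' unfolding m_def by (meson Max_ge leD)
      then have "\<omega> s t / 2 < \<omega> s m'"
        using m m' False unfolding E_def by auto
      then show ?thesis
        using add[of s m' t] less.prems m m' by simp
    qed
    \<comment> \<open>The left piece misses \<open>t\<close> and the right piece misses
      \<open>s\<close>, so the induction hypothesis applies to both.\<close>
    have "s \<in> D \<inter> {s..t} - D \<inter> {m'..t}" "t \<in> D \<inter> {s..t} - D \<inter> {s..m}"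
      "D \<inter> {s..m} \<subseteq> D \<inter> {s..t}" "D \<inter> {m'..t} \<subseteq> D \<inter> {s..t}"
      using less.prems m m' by auto
    then have "D \<inter> {s..m} \<subset> D \<inter> {s..t}" "D \<inter> {m'..t} \<subset> D \<inter> {s..t}"
      by blast+
    then have card1: "card (D \<inter> {s..m}) < card (D \<inter> {s..t})"
      and card2: "card (D \<inter> {m'..t}) < card (D \<inter> {s..t})"
      using \<open>finite D\<close> by (simp_all add: psubset_card_mono)
    have le_half: "C * \<omega> a b powr \<theta> \<le> C * (\<omega> s t powr \<theta> / 2 powr \<theta>)"
      if "\<omega> a b \<le> \<omega> s t / 2" "a \<in> D" "b \<in> D" "a \<le> b" for a b
    proof -
      have "\<omega> a b powr \<theta> \<le> (\<omega> s t / 2) powr \<theta>"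
        using that nonneg \<open>0 \<le> \<theta>\<close> by (intro powr_mono2) auto
      then show ?thesis
        using C0 w0 by (intro mult_left_mono) (simp_all add: powr_divide)
    qed
    let ?h = "\<omega> s t powr \<theta>"
    have "norm (Y m - \<mu> s m (Y s)) \<le> C * \<omega> s m powr \<theta>"
      using less.hyps[OF card1] less.prems m sub[of s m] by simp
    also have "\<dots> \<le> C * (?h / 2 powr \<theta>)"
      using less.prems m by (intro le_half) auto
    finally have J1: "norm (Y m - \<mu> s m (Y s)) \<le> C * (?h / 2 powr \<theta>)" .
    have "norm (Y t - \<mu> m' t (Y m')) \<le> C * \<omega> m' t powr \<theta>"
      using less.hyps[OF card2] less.prems m m' sub[of m' t] by simp
    also have "\<dots> \<le> C * (?h / 2 powr \<theta>)"
      using half less.prems m m' by (intro le_half) auto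
    finally have J2: "norm (Y t - \<mu> m' t (Y m')) \<le> C * (?h / 2 powr \<theta>)" .
    have Ym': "Y m' = \<mu> m m' (Y m)"
      using m m' adj by (intro step) auto
    have "norm (\<mu> m' t (\<mu> m m' (Y m)) - \<mu> m t (Y m)) \<le> K * \<omega> m t powr \<theta>"
      using almost[of m m' t] m m' less.prems sub[of m t] by simp
    also have "\<dots> \<le> K * ?h"
      using \<open>0 \<le> K\<close> \<open>0 \<le> \<theta>\<close> nonneg[of m t] sub[of m t] m less.prems
      by (intro mult_left_mono powr_mono2) auto
    finally have J3: "norm (\<mu> m' t (Y m') - \<mu> m t (Y m)) \<le> K * ?h"
      by (simp add: Ym')
    have "norm (\<mu> m t (Y m) - \<mu> m t (\<mu> s m (Y s))) \<le> \<Lambda> * norm (Y m - \<mu> s m (Y s))"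
      using lip[of m t] m less.prems sub[of m t] by simp
    also have "\<dots> \<le> \<Lambda> * (C * (?h / 2 powr \<theta>))"
      using J1 \<open>0 \<le> \<Lambda>\<close> by (rule mult_left_mono)
    finally have J4: "norm (\<mu> m t (Y m) - \<mu> m t (\<mu> s m (Y s))) \<le> \<Lambda> * (C * (?h / 2 powr \<theta>))" .
    have J5: "norm (\<mu> m t (\<mu> s m (Y s)) - \<mu> s t (Y s)) \<le> K * ?h"
      using almost[of s m t] m less.prems by simp
    \<comment> \<open>Telescoping: error on the right piece, merging of the steps \<open>m\<close>
      to \<open>m'\<close> to \<open>t\<close>, transported error of the left piece, merging of the
      steps \<open>s\<close> to \<open>m\<close> to \<open>t\<close>.\<close>
    have "Y t - \<mu> s t (Y s) = (Y t - \<mu> m' t (Y m')) + (\<mu> m' t (Y m') - \<mu> m t (Y m))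
        + (\<mu> m t (Y m) - \<mu> m t (\<mu> s m (Y s))) + (\<mu> m t (\<mu> s m (Y s)) - \<mu> s t (Y s))"
      by simp
    also have "norm \<dots> \<le> C * (?h / 2 powr \<theta>) + K * ?h + \<Lambda> * (C * (?h / 2 powr \<theta>)) + K * ?h"
      by (intro norm_triangle_mono J2 J3 J4 J5)
    also have "\<dots> = (C * ((1 + \<Lambda>) / 2 powr \<theta>) + 2 * K) * ?h"
      by (simp add: algebra_simps add_divide_distrib)
    finally show ?thesis
      unfolding C_eq .
  qed
qed

text \<open>The constraint for one pair of times involves \<open>Y\<close> only at \<open>S\<close>,
  \<open>s\<close> and \<open>t\<close>, so it is closed under pointwise convergence. Finitely many
  constraints are met by an Euler scheme through the times involved, with a constant that does not
  depend on them; the finite intersection property in the compact space of all functions into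
  \<open>B\<close> yields a common solution.\<close>

lemma almost_flow_has_solution:
  fixes \<mu> :: "real \<Rightarrow> real \<Rightarrow> 'a::real_normed_vector \<Rightarrow> 'a"
  assumes "S \<le> T"
    and nonneg: "\<And>s t. \<lbrakk>s \<in> {S..T}; t \<in> {S..T}; s \<le> t\<rbrakk> \<Longrightarrow> 0 \<le> \<omega> s t"
    and zero: "\<And>s. s \<in> {S..T} \<Longrightarrow> \<omega> s s = 0"
    and super: "superadditive_on {S..T} \<omega>"
    and id: "\<And>s y. s \<in> {S..T} \<Longrightarrow> \<mu> s s y = y"
    and lip: "\<And>s t y z. \<lbrakk>s \<in> {S..T}; t \<in> {S..T}; s \<le> t; \<omega> s t \<le> \<delta>\<rbrakk> \<Longrightarrow>
      norm (\<mu> s t z - \<mu> s t y) \<le> \<Lambda> * norm (z - y)"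
    and almost: "\<And>s u t y. \<lbrakk>s \<in> {S..T}; u \<in> {S..T}; t \<in> {S..T}; s \<le> u; u \<le> t; \<omega> s t \<le> \<delta>\<rbrakk> \<Longrightarrow>
      norm (\<mu> u t (\<mu> s u y) - \<mu> s t y) \<le> K * \<omega> s t powr \<theta>"
    and "0 \<le> \<Lambda>" "0 \<le> K" "0 \<le> \<theta>" "1 + \<Lambda> < 2 powr \<theta>"
    and "compact B" "y0 \<in> B"
    and inv: "\<And>s t y. \<lbrakk>s \<in> {S..T}; t \<in> {S..T}; s \<le> t; y \<in> B\<rbrakk> \<Longrightarrow> \<mu> s t y \<in> B"
  shows "\<exists>Y C. Y S = y0 \<and> (\<forall>t. Y t \<in> B) \<and> (\<forall>s t. S \<le> s \<and> s \<le> t \<and> t \<le> T \<and> \<omega> s t \<le> \<delta> \<longrightarrow>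
    norm (Y t - \<mu> s t (Y s)) \<le> C * \<omega> s t powr \<theta>)"
proof -
  define C where "C = 2 * K / (1 - (1 + \<Lambda>) / 2 powr \<theta>)"
  define I where "I = {(s, t). S \<le> s \<and> s \<le> t \<and> t \<le> T \<and> \<omega> s t \<le> \<delta>}"
  \<comment> \<open>The initial condition is built into every constraint, so it passes to the limit
    together with the estimate.\<close>
  define G where "G = (\<lambda>(s, t). {Y :: real \<Rightarrow> 'a. Y S = y0 \<and>
    norm (Y t - \<mu> s t (Y s)) \<le> C * \<omega> s t powr \<theta>})"
  have "compactin (product_topology (\<lambda>_. euclidean) UNIV) (PiE UNIV (\<lambda>_::real. B))"
    using \<open>compact B\<close> by (simp add: compactin_PiE del: PiE_UNIV_domain)
  then have cpt: "compact (Pi UNIV (\<lambda>_::real. B))"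
    by (simp add: euclidean_product_topology PiE_UNIV_domain)
  have cl: "closed (G i)" if "i \<in> I" for i
  proof -
    obtain s t where i: "i = (s, t)" "S \<le> s" "s \<le> t" "t \<le> T" "\<omega> s t \<le> \<delta>"
      using \<open>i \<in> I\<close> unfolding I_def by (cases i) auto
    \<comment> \<open>Closedness needs continuity of \<open>\<mu> s t\<close>; the Lipschitz bound
      supplies it for the pairs in \<open>I\<close>, whose control is at most
      \<open>\<delta>\<close>.\<close>
    have "\<Lambda>-lipschitz_on UNIV (\<mu> s t)"
      using lip i \<open>0 \<le> \<Lambda>\<close> by (intro lipschitz_onI) (auto simp: dist_norm)
    then have "continuous_on UNIV (\<mu> s t)"
      by (rule lipschitz_on_continuous_on)
    then have "continuous_on UNIV (\<lambda>Y. \<mu> s t (Y s))"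
      by (rule continuous_on_compose2) auto
    then show ?thesis
      unfolding G_def i(1) prod.case
      by (intro closed_Collect_conj closed_Collect_eq closed_Collect_le continuous_intros) auto
  qed
  have "Pi UNIV (\<lambda>_. B) \<inter> (\<Inter>i\<in>I'. G i) \<noteq> {}" if I': "finite I'" "I' \<subseteq> I" for I'
  proof -
    \<comment> \<open>\<open>S\<close> is removed because the scheme treats its starting time
      separately; it is put back as \<open>insert S D\<close> for the estimate.\<close>
    define D where "D = (fst ` I' \<union> snd ` I') - {S}"
    \<comment> \<open>The existence of schemes asks for a family preserving \<open>B\<close> at all
      pairs of reals, hence the extension of \<open>\<mu>\<close> by the identity.\<close>
    define \<nu> where "\<nu> s t = (if s \<in> {S..T} \<and> t \<in> {S..T} \<and> s \<le> t then \<mu> s t else id)" for s t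
    have D: "finite D" "D \<subseteq> {S<..T}"
      using I' unfolding D_def I_def by force+
    have "\<exists>Y. Y S = y0 \<and> (\<forall>t. Y t \<in> B) \<and>
        (\<forall>s\<in>insert S D. \<forall>t\<in>D. s < t \<and> (\<forall>u\<in>D. u \<le> s \<or> t \<le> u) \<longrightarrow> Y t = \<nu> s t (Y s))"
      using D inv \<open>y0 \<in> B\<close> by (intro exists_Euler_scheme) (auto simp: \<nu>_def)
    then obtain Y where Y: "Y S = y0" "\<And>t. Y t \<in> B"
      "\<And>s t. \<lbrakk>s \<in> insert S D; t \<in> D; s < t; \<forall>u\<in>D. u \<le> s \<or> t \<le> u\<rbrakk> \<Longrightarrow> Y t = \<nu> s t (Y s)"
      by blast
    have D': "finite (insert S D)" "insert S D \<subseteq> {S..T}"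
      using D \<open>S \<le> T\<close> by auto
    have super': "superadditive_on (insert S D) \<omega>"
      using super D'(2) unfolding superadditive_on_def by blast
    have "Y \<in> G i" if "i \<in> I'" for i
    proof -
      obtain s t where i: "i = (s, t)" "S \<le> s" "s \<le> t" "t \<le> T" "\<omega> s t \<le> \<delta>"
        using \<open>i \<in> I'\<close> I' unfolding I_def by (cases i) auto
      have st: "s \<in> insert S D" "t \<in> insert S D"
        using that unfolding D_def i(1) by force+
      have step: "Y t = \<mu> s t (Y s)"
        if "s \<in> insert S D" "t \<in> insert S D" "s < t" "\<forall>u\<in>insert S D. u \<le> s \<or> t \<le> u" for s t
      proof -
        have "t \<in> D" "s \<in> {S..T}" "t \<in> {S..T}"
          using that D'(2) D(2) by auto
        then show ?thesis
          using that Y(3)[of s t] by (simp add: \<nu>_def)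
      qed
      have "norm (Y t - \<mu> s t (Y s)) \<le> C * \<omega> s t powr \<theta>"
        by (rule Euler_scheme_estimate[where D = "insert S D" and \<omega> = \<omega> and \<mu> = \<mu> and Y = Y and s = s and t = t, OF D'(1) _ _ super' _ _ _
              \<open>0 \<le> \<Lambda>\<close> \<open>0 \<le> K\<close> \<open>0 \<le> \<theta>\<close> \<open>1 + \<Lambda> < 2 powr \<theta>\<close> step C_def st i(3) i(5)])
          (use D'(2) in \<open>auto intro!: nonneg zero id lip almost\<close>)
      then show ?thesis
        using Y(1) by (simp add: G_def i(1))
    qed
    then have "Y \<in> Pi UNIV (\<lambda>_. B) \<inter> (\<Inter>i\<in>I'. G i)"
      using Y(2) by blast
    then show ?thesis
      by blast
  qed
  then have "Pi UNIV (\<lambda>_. B) \<inter> (\<Inter>i\<in>I. G i) \<noteq> {}"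
    using compact_imp_fip_image[of "Pi UNIV (\<lambda>_. B)" I G] cpt cl by blast
  then obtain Y where Y: "\<And>t. Y t \<in> B" "\<And>i. i \<in> I \<Longrightarrow> Y \<in> G i"
    by blast
  show ?thesis
  \<comment> \<open>\<open>I\<close> is empty exactly when \<open>\<delta>\<close> is negative. Then
    no constraint fixes the initial value, but the constant function \<open>y0\<close> satisfies the
    claim vacuously.\<close>
  proof (cases "I = {}")
    case True
    then show ?thesis
      using \<open>y0 \<in> B\<close> unfolding I_def by (intro exI[of _ "\<lambda>_. y0"]) auto
  next
    case False
    then have "Y S = y0"
      using Y(2) unfolding G_def by fastforce
    then show ?thesis
      using Y unfolding I_def G_def by (intro exI[of _ Y] exI[of _ C]) auto
  qed
qed

section \<open>The Euler step of a branched rough path\<close>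

lemma UNIV_forest:
  "(UNIV :: 'n forest set) = range Vertex \<union> range Vertices \<union> range (case_prod Ladder)"
  by (auto simp: image_iff) (metis forest.exhaust)

lemma finite_UNIV_uprod: "finite (UNIV :: 'n::finite uprod set)"
  by (simp add: UNIV_uprod)

text \<open>An unordered pair has \<open>2 / symmetry_factor\<close> ordered representatives: two if
  the labels differ, one if they agree. Passing to ordered pairs thus replaces all symmetry factors
  by a uniform 1/2.\<close>

lemma sum_uprod_symmetry_factor:
  fixes g :: "'n::finite uprod \<Rightarrow> real"
  shows "(\<Sum>u\<in>UNIV. 1 / real (symmetry_factor (Vertices u)) * g u) = (\<Sum>a\<in>UNIV. \<Sum>b\<in>UNIV. g (Upair a b)) / 2"
proof -
  have fibre: "real (card {x. case_prod Upair x = u}) = 2 / real (symmetry_factor (Vertices u))"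
    for u :: "'n uprod"
  proof (cases u)
    case (Upair a b)
    have "{x. case_prod Upair x = u} = {(a, b), (b, a)}"
      by (auto simp: Upair)
    then show ?thesis
      by (cases "a = b") (auto simp: Upair)
  qed
  have "(\<Sum>a\<in>UNIV. \<Sum>b\<in>UNIV. g (Upair a b)) = (\<Sum>x\<in>UNIV. g (case_prod Upair x))"
    by (simp add: sum.cartesian_product case_prod_beta)
  also have "\<dots> = (\<Sum>u\<in>UNIV. \<Sum>x | x \<in> UNIV \<and> case_prod Upair x = u. g (case_prod Upair x))"
    by (rule sum.group[symmetric]) (auto simp: finite_UNIV_uprod)
  also have "\<dots> = (\<Sum>u\<in>UNIV. real (card {x. case_prod Upair x = u}) * g u)"
    by (intro sum.cong) auto
  finally show ?thesis
    by (simp add: fibre sum_divide_distrib)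
qed

lemma sum_forest_symmetry_factor:
  fixes g :: "'n::finite forest \<Rightarrow> real"
  shows "(\<Sum>\<tau>\<in>UNIV. 1 / real (symmetry_factor \<tau>) * g \<tau>) =
    (\<Sum>a\<in>UNIV. g (Vertex a)) + (\<Sum>a\<in>UNIV. \<Sum>b\<in>UNIV. g (Vertices (Upair a b))) / 2 +
    (\<Sum>a\<in>UNIV. \<Sum>b\<in>UNIV. g (Ladder a b))"
proof -
  let ?g = "\<lambda>\<tau>. 1 / real (symmetry_factor \<tau>) * g \<tau>"
  have "sum ?g UNIV = sum ?g (range Vertex) + sum ?g (range Vertices) + sum ?g (range (case_prod Ladder))"
    unfolding UNIV_forest by (subst sum.union_disjoint; (auto simp: finite_UNIV_uprod)?)+
  also have "sum ?g (range Vertex) = (\<Sum>a\<in>UNIV. g (Vertex a))"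
    by (subst sum.reindex) (auto simp: inj_def)
  also have "sum ?g (range Vertices) = (\<Sum>u\<in>UNIV. ?g (Vertices u))"
    by (subst sum.reindex) (auto simp: inj_def)
  also have "\<dots> = (\<Sum>a\<in>UNIV. \<Sum>b\<in>UNIV. g (Vertices (Upair a b))) / 2"
    by (rule sum_uprod_symmetry_factor)
  also have "sum ?g (range (case_prod Ladder)) = (\<Sum>a\<in>UNIV. \<Sum>b\<in>UNIV. g (Ladder a b))"
    by (subst sum.reindex) (auto simp: inj_def sum.cartesian_product case_prod_beta)
  finally show ?thesis .
qed

lemma symmetry_factor_ge_1: "1 \<le> symmetry_factor \<tau>"
  by (cases \<tau>) auto

definition Euler_step ::
  "('m::finite \<Rightarrow> 'n::finite forest \<Rightarrow> real ^ 'm \<Rightarrow> real) \<Rightarrow> ('n forest \<Rightarrow> real \<Rightarrow> real \<Rightarrow> real) \<Rightarrow>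
   real \<Rightarrow> real \<Rightarrow> real ^ 'm \<Rightarrow> real ^ 'm" where
  "Euler_step f X s t y =
     (\<chi> i. y $ i + (\<Sum>\<tau>\<in>UNIV. 1 / real (symmetry_factor \<tau>) * f i \<tau> y * X \<tau> s t))"

lemma Euler_step_nth:
  "Euler_step f X s t y $ i = y $ i + (\<Sum>a\<in>UNIV. f i (Vertex a) y * X (Vertex a) s t)
    + (\<Sum>a\<in>UNIV. \<Sum>b\<in>UNIV. f i (Vertices (Upair a b)) y * X (Vertices (Upair a b)) s t) / 2
    + (\<Sum>a\<in>UNIV. \<Sum>b\<in>UNIV. f i (Ladder a b) y * X (Ladder a b) s t)"
  using sum_forest_symmetry_factor[of "\<lambda>\<tau>. f i \<tau> y * X \<tau> s t"]
  by (simp add: Euler_step_def)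

text \<open>The number \<open>h s t\<close> stands for \<open>\<omega>(s,t)\<^sup>1\<^sup>/\<^sup>p\<close>, so that all estimates are polynomial in it.\<close>

locale bounded_rough_equation =
  fixes S T :: real
    and f :: "'m::finite \<Rightarrow> 'n::finite forest \<Rightarrow> real ^ 'm \<Rightarrow> real"
    and X :: "'n forest \<Rightarrow> real \<Rightarrow> real \<Rightarrow> real"
    and h :: "real \<Rightarrow> real \<Rightarrow> real"
    and F L A H :: real
  assumes nonneg: "0 \<le> F" "0 \<le> L" "0 \<le> A" "0 \<le> H"
    and admissible: "admissible f"
    and f_bound: "\<bar>f i \<tau> y\<bar> \<le> F"
    and df_bound: "\<bar>partial_derivative j (f i \<tau>) y\<bar> \<le> F"
    and f_Lipschitz: "\<bar>f i \<tau> z - f i \<tau> y\<bar> \<le> L * norm (z - y)"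
    and f_Taylor: "\<bar>f i \<tau> z - f i \<tau> y - (\<Sum>j\<in>UNIV. partial_derivative j (f i \<tau>) y * (z $ j - y $ j))\<bar>
      \<le> L * (norm (z - y))\<^sup>2"
    and X_Vertex: "\<lbrakk>S \<le> s; s \<le> u; u \<le> t; t \<le> T\<rbrakk> \<Longrightarrow>
      X (Vertex a) s t = X (Vertex a) s u + X (Vertex a) u t"
    and X_Vertices: "\<lbrakk>S \<le> s; s \<le> t; t \<le> T\<rbrakk> \<Longrightarrow>
      X (Vertices (Upair a b)) s t = X (Vertex a) s t * X (Vertex b) s t"
    and X_Ladder: "\<lbrakk>S \<le> s; s \<le> u; u \<le> t; t \<le> T\<rbrakk> \<Longrightarrow>
      X (Ladder a b) s t = X (Ladder a b) s u + X (Ladder a b) u t + X (Vertex a) s u * X (Vertex b) u t"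
    and X_Vertex_bound: "\<lbrakk>S \<le> s; s \<le> t; t \<le> T\<rbrakk> \<Longrightarrow> \<bar>X (Vertex a) s t\<bar> \<le> A * h s t"
    and X_Vertices_bound: "\<lbrakk>S \<le> s; s \<le> t; t \<le> T\<rbrakk> \<Longrightarrow> \<bar>X (Vertices (Upair a b)) s t\<bar> \<le> A * (h s t)\<^sup>2"
    and X_Ladder_bound: "\<lbrakk>S \<le> s; s \<le> t; t \<le> T\<rbrakk> \<Longrightarrow> \<bar>X (Ladder a b) s t\<bar> \<le> A * (h s t)\<^sup>2"
    and h_nonneg: "\<lbrakk>S \<le> s; s \<le> t; t \<le> T\<rbrakk> \<Longrightarrow> 0 \<le> h s t"
    and h_le: "\<lbrakk>S \<le> s; s \<le> t; t \<le> T\<rbrakk> \<Longrightarrow> h s t \<le> H"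
    and h_mono: "\<lbrakk>S \<le> s; s \<le> u; u \<le> v; v \<le> t; t \<le> T\<rbrakk> \<Longrightarrow> h u v \<le> h s t"
begin

section \<open>Size and regularity of a single Euler step\<close>

abbreviation "\<mu> \<equiv> Euler_step f X"

text \<open>As \<open>h\<close> is bounded by \<open>H\<close>, the quadratic components are also of
  first order in \<open>h\<close>, which allows a uniform treatment of all forests where only first
  order matters.\<close>

lemma X_bound:
  assumes "S \<le> s" "s \<le> t" "t \<le> T"
  shows "\<bar>X \<tau> s t\<bar> \<le> A * (1 + H) * h s t"
proof -
  have h: "0 \<le> h s t" "h s t \<le> H"
    using assms h_nonneg h_le by auto
  have "A * h s t \<le> A * (1 + H) * h s t"
    using h nonneg by (simp add: algebra_simps)
  moreover have "A * (h s t)\<^sup>2 \<le> A * (1 + H) * h s t"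
    using h nonneg by (simp add: power2_eq_square algebra_simps add_increasing mult_left_mono mult_right_mono)
  moreover have "\<bar>X \<tau> s t\<bar> \<le> A * h s t \<or> \<bar>X \<tau> s t\<bar> \<le> A * (h s t)\<^sup>2"
    using X_Vertex_bound[OF assms] X_Vertices_bound[OF assms] X_Ladder_bound[OF assms]
    by (metis forest.exhaust uprod_exhaust)
  ultimately show ?thesis
    by linarith
qed

text \<open>Used with the values of \<open>f\<close> as coefficients for the size of a step, and
  with differences of values for its Lipschitz constant.\<close>

lemma weighted_sum_bound:
  assumes "S \<le> s" "s \<le> t" "t \<le> T" "\<And>\<tau>. \<bar>c \<tau>\<bar> \<le> B"
  shows "\<bar>\<Sum>\<tau>\<in>UNIV. 1 / real (symmetry_factor \<tau>) * c \<tau> * X \<tau> s t\<bar>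
    \<le> real CARD('n forest) * (A * (1 + H) * B * h s t)"
proof -
  have "\<bar>1 / real (symmetry_factor \<tau>) * c \<tau> * X \<tau> s t\<bar> \<le> A * (1 + H) * B * h s t" for \<tau>
  proof -
    have "\<bar>1 / real (symmetry_factor \<tau>) * c \<tau> * X \<tau> s t\<bar> = 1 / real (symmetry_factor \<tau>) * (\<bar>c \<tau>\<bar> * \<bar>X \<tau> s t\<bar>)"
      by (simp add: abs_mult)
    also have "\<dots> \<le> 1 * (\<bar>c \<tau>\<bar> * \<bar>X \<tau> s t\<bar>)"
      using symmetry_factor_ge_1[of \<tau>] by (intro mult_right_mono) auto
    also have "\<dots> \<le> 1 * (B * (A * (1 + H) * h s t))"
      using assms X_bound by (intro mult_left_mono mult_mono) (auto intro: order_trans[OF abs_ge_zero])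
    finally show ?thesis
      by (simp add: mult_ac)
  qed
  then show ?thesis
    unfolding real_norm_def[symmetric] by (intro sum_norm_bound)
qed

definition "Z = real CARD('m) * (real CARD('n forest) * (A * (1 + H) * F))"

lemma Z_nonneg: "0 \<le> Z"
  unfolding Z_def using nonneg by simp

lemma norm_le_CARD:
  fixes v :: "real ^ 'm"
  assumes "\<And>i. \<bar>v $ i\<bar> \<le> c"
  shows "norm v \<le> real CARD('m) * c"
  using norm_le_l1_cart[of v] sum_bounded_above[of UNIV "\<lambda>i. \<bar>v $ i\<bar>" c] assms by force

lemma Euler_step_increment:
  assumes "S \<le> s" "s \<le> t" "t \<le> T"
  shows "norm (\<mu> s t y - y) \<le> Z * h s t"
proof -
  have "norm (\<mu> s t y - y) \<le> real CARD('m) * (real CARD('n forest) * (A * (1 + H) * F * h s t))"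
    using weighted_sum_bound[OF assms f_bound] by (intro norm_le_CARD) (simp add: Euler_step_def)
  then show ?thesis
    by (simp add: Z_def mult_ac)
qed

text \<open>The identity part of the step is split off, so that the Lipschitz constant approaches 1
  as \<open>h\<close> tends to 0. This is what brings \<open>1 + \<Lambda>\<close> below
  \<open>2 powr \<theta>\<close> for small control.\<close>

lemma Euler_step_Lipschitz:
  assumes "S \<le> s" "s \<le> t" "t \<le> T"
  shows "norm (\<mu> s t z - \<mu> s t y) \<le>
    (1 + real CARD('m) * (real CARD('n forest) * (A * (1 + H) * L)) * h s t) * norm (z - y)"
proof -
  let ?v = "(\<mu> s t z - \<mu> s t y) - (z - y)"
  have "?v $ i = (\<Sum>\<tau>\<in>UNIV. 1 / real (symmetry_factor \<tau>) * (f i \<tau> z - f i \<tau> y) * X \<tau> s t)" for i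
    by (simp add: Euler_step_def sum_subtractf algebra_simps)
  then have "norm ?v \<le> real CARD('m) * (real CARD('n forest) * (A * (1 + H) * (L * norm (z - y)) * h s t))"
    using weighted_sum_bound[OF assms f_Lipschitz] by (intro norm_le_CARD) simp
  then have "norm ?v \<le> real CARD('m) * (real CARD('n forest) * (A * (1 + H) * L)) * h s t * norm (z - y)"
    by (simp add: mult_ac)
  moreover have "norm (\<mu> s t z - \<mu> s t y) \<le> norm (z - y) + norm ?v"
    by (rule norm_triangle_sub)
  ultimately show ?thesis
    by (simp add: distrib_right)
qed

lemma Euler_step_refl:
  assumes "S \<le> s" "s \<le> T" "h s s = 0"
  shows "\<mu> s s y = y"
  using Euler_step_increment[of s s y] assms by simp


section \<open>The defect of composing two Euler steps\<close>

lemma Euler_step_remainder: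
  assumes "S \<le> s" "s \<le> t" "t \<le> T"
  shows "\<bar>\<mu> s t y $ j - y $ j - (\<Sum>a\<in>UNIV. f j (Vertex a) y * X (Vertex a) s t)\<bar>
    \<le> 2 * (real CARD('n))\<^sup>2 * F * A * (h s t)\<^sup>2"
proof -
  let ?P = "\<Sum>a\<in>UNIV. \<Sum>b\<in>UNIV. f j (Vertices (Upair a b)) y * X (Vertices (Upair a b)) s t"
  let ?Q = "\<Sum>a\<in>UNIV. \<Sum>b\<in>UNIV. f j (Ladder a b) y * X (Ladder a b) s t"
  have "\<mu> s t y $ j - y $ j - (\<Sum>a\<in>UNIV. f j (Vertex a) y * X (Vertex a) s t) = ?P / 2 + ?Q"
    by (simp add: Euler_step_nth)
  moreover have "norm ?P \<le> real CARD('n) * (real CARD('n) * (F * (A * (h s t)\<^sup>2)))"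
    using f_bound X_Vertices_bound[OF assms] nonneg(1)
    by (intro sum_norm_bound) (auto simp: abs_mult intro!: mult_mono)
  moreover have "norm ?Q \<le> real CARD('n) * (real CARD('n) * (F * (A * (h s t)\<^sup>2)))"
    using f_bound X_Ladder_bound[OF assms] nonneg(1)
    by (intro sum_norm_bound) (auto simp: abs_mult intro!: mult_mono)
  \<comment> \<open>The factor 1 + 1/2 is rounded up to 2.\<close>
  ultimately show ?thesis
    by (simp add: power2_eq_square mult_ac)
qed

text \<open>An exact identity in which all terms of order below three have cancelled. What remains
  is the Taylor remainder times a first order term, the derivative applied to the second order part
  of the step times a first order term, and increments of the second order coefficients times second
  order terms. Chen's relations and admissibility produce the cancellation.\<close>

lemma Euler_step_composition:
  fixes y :: "real ^ 'm"
  assumes st: "S \<le> s" "s \<le> u" "u \<le> t" "t \<le> T"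
    and z: "z = \<mu> s u y"
  shows "(\<mu> u t z - \<mu> s t y) $ i =
    (\<Sum>b\<in>UNIV. (f i (Vertex b) z - f i (Vertex b) y
        - (\<Sum>j\<in>UNIV. partial_derivative j (f i (Vertex b)) y * (z $ j - y $ j))) * X (Vertex b) u t) +
    (\<Sum>b\<in>UNIV. (\<Sum>j\<in>UNIV. partial_derivative j (f i (Vertex b)) y *
        (z $ j - y $ j - (\<Sum>a\<in>UNIV. f j (Vertex a) y * X (Vertex a) s u))) * X (Vertex b) u t) +
    (\<Sum>a\<in>UNIV. \<Sum>b\<in>UNIV. (f i (Vertices (Upair a b)) z - f i (Vertices (Upair a b)) y) *
        X (Vertices (Upair a b)) u t) / 2 +
    (\<Sum>a\<in>UNIV. \<Sum>b\<in>UNIV. (f i (Ladder a b) z - f i (Ladder a b) y) * X (Ladder a b) u t)"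
    (is "_ = ?R1 + ?R2 + ?R3 / 2 + ?R4")
proof -
  define x where "x b = X (Vertex b) s u" for b
  define w where "w b = X (Vertex b) u t" for b
  define P where "P a b = f i (Vertices (Upair a b))" for a b
  define Q where "Q a b = f i (Ladder a b)" for a b
  define d where "d j b = partial_derivative j (f i (Vertex b)) y" for j b
  have wx: "X (Vertex b) s t = x b + w b" for b
    unfolding x_def w_def using st by (intro X_Vertex)
  have Pst: "X (Vertices (Upair a b)) s t = (x a + w a) * (x b + w b)"
    and Psu: "X (Vertices (Upair a b)) s u = x a * x b"
    and Put: "X (Vertices (Upair a b)) u t = w a * w b" for a b
    using X_Vertices[of s t] X_Vertices[of s u] X_Vertices[of u t] wx st by (simp_all add: x_def w_def)
  have Qst: "X (Ladder a b) s t = X (Ladder a b) s u + X (Ladder a b) u t + x a * w b" for a b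
    unfolding x_def w_def using st by (intro X_Ladder)
  have adm: "(\<Sum>j\<in>UNIV. d j b * f j (Vertex a) y) = P a b y + Q a b y" for a b
    using admissible unfolding admissible_def d_def P_def Q_def by blast
  \<comment> \<open>The product rule for \<open>s\<close>, \<open>t\<close> creates two mixed terms.
    They agree because the coefficients are symmetric in the labels, so half of their sum is one of
    them, as admissibility requires.\<close>
  have P_sym: "(\<Sum>a\<in>UNIV. \<Sum>b\<in>UNIV. P a b y * (w a * x b)) = (\<Sum>a\<in>UNIV. \<Sum>b\<in>UNIV. P a b y * (x a * w b))"
  proof -
    have "P a b = P b a" for a b
      unfolding P_def by (metis Upair_inject)
    then show ?thesis
      by (subst sum.swap) (simp add: mult.commute)
  qed
  \<comment> \<open>Admissibility converts the derivative along the first order part of the step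
    into the second order coefficients.\<close>
  have "(\<Sum>j\<in>UNIV. d j b * (\<Sum>a\<in>UNIV. f j (Vertex a) y * x a)) = (\<Sum>a\<in>UNIV. (P a b y + Q a b y) * x a)" for b
    unfolding adm[symmetric] sum_distrib_left sum_distrib_right
    by (subst sum.swap) (simp add: mult.assoc)
  then have "(\<Sum>b\<in>UNIV. (f i (Vertex b) z - f i (Vertex b) y) * w b) =
      ?R1 + ?R2 + (\<Sum>b\<in>UNIV. (\<Sum>a\<in>UNIV. (P a b y + Q a b y) * x a) * w b)"
    by (simp add: w_def[symmetric] x_def[symmetric] d_def[symmetric] right_diff_distrib
        sum_subtractf left_diff_distrib)
  also have "(\<Sum>b\<in>UNIV. (\<Sum>a\<in>UNIV. (P a b y + Q a b y) * x a) * w b) =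
      (\<Sum>a\<in>UNIV. \<Sum>b\<in>UNIV. P a b y * (x a * w b)) + (\<Sum>a\<in>UNIV. \<Sum>b\<in>UNIV. Q a b y * (x a * w b))"
    unfolding sum_distrib_right by (subst sum.swap) (simp add: sum.distrib algebra_simps)
  finally have V: "(\<Sum>b\<in>UNIV. (f i (Vertex b) z - f i (Vertex b) y) * w b) = ?R1 + ?R2
      + (\<Sum>a\<in>UNIV. \<Sum>b\<in>UNIV. P a b y * (x a * w b)) + (\<Sum>a\<in>UNIV. \<Sum>b\<in>UNIV. Q a b y * (x a * w b))"
    by (simp only: add.assoc)
  \<comment> \<open>The remaining identities express everything through the same few sums, so that
    the conclusion is linear in them.\<close>
  have "(\<Sum>b\<in>UNIV. (f i (Vertex b) z - f i (Vertex b) y) * w b) = (\<Sum>b\<in>UNIV. f i (Vertex b) y * x b)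
      + (\<Sum>b\<in>UNIV. f i (Vertex b) z * w b) - (\<Sum>b\<in>UNIV. f i (Vertex b) y * (x b + w b))"
    by (simp add: sum.distrib sum_subtractf algebra_simps)
  moreover have "?R3 = (\<Sum>a\<in>UNIV. \<Sum>b\<in>UNIV. P a b y * (x a * x b))
      + (\<Sum>a\<in>UNIV. \<Sum>b\<in>UNIV. P a b z * (w a * w b))
      - (\<Sum>a\<in>UNIV. \<Sum>b\<in>UNIV. P a b y * ((x a + w a) * (x b + w b)))
      + (\<Sum>a\<in>UNIV. \<Sum>b\<in>UNIV. P a b y * (x a * w b)) + (\<Sum>a\<in>UNIV. \<Sum>b\<in>UNIV. P a b y * (w a * x b))"
    unfolding P_def[symmetric] Put by (simp add: sum.distrib sum_subtractf algebra_simps)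
  moreover have "?R4 = (\<Sum>a\<in>UNIV. \<Sum>b\<in>UNIV. Q a b y * X (Ladder a b) s u)
      + (\<Sum>a\<in>UNIV. \<Sum>b\<in>UNIV. Q a b z * X (Ladder a b) u t)
      - (\<Sum>a\<in>UNIV. \<Sum>b\<in>UNIV. Q a b y * (X (Ladder a b) s u + X (Ladder a b) u t + x a * w b))
      + (\<Sum>a\<in>UNIV. \<Sum>b\<in>UNIV. Q a b y * (x a * w b))"
    unfolding Q_def[symmetric] by (simp add: sum.distrib sum_subtractf algebra_simps)
  moreover have "z $ i = y $ i + (\<Sum>b\<in>UNIV. f i (Vertex b) y * x b)
      + (\<Sum>a\<in>UNIV. \<Sum>b\<in>UNIV. P a b y * (x a * x b)) / 2 + (\<Sum>a\<in>UNIV. \<Sum>b\<in>UNIV. Q a b y * X (Ladder a b) s u)"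
    unfolding z by (simp add: Euler_step_nth x_def[symmetric]
        Psu P_def[symmetric] Q_def[symmetric])
  moreover have "\<mu> u t z $ i = z $ i + (\<Sum>b\<in>UNIV. f i (Vertex b) z * w b)
      + (\<Sum>a\<in>UNIV. \<Sum>b\<in>UNIV. P a b z * (w a * w b)) / 2 + (\<Sum>a\<in>UNIV. \<Sum>b\<in>UNIV. Q a b z * X (Ladder a b) u t)"
    by (simp add: Euler_step_nth w_def[symmetric]
        Put P_def[symmetric] Q_def[symmetric])
  moreover have "\<mu> s t y $ i = y $ i + (\<Sum>b\<in>UNIV. f i (Vertex b) y * (x b + w b))
      + (\<Sum>a\<in>UNIV. \<Sum>b\<in>UNIV. P a b y * ((x a + w a) * (x b + w b))) / 2
      + (\<Sum>a\<in>UNIV. \<Sum>b\<in>UNIV. Q a b y * (X (Ladder a b) s u + X (Ladder a b) u t + x a * w b))"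
    by (simp add: Euler_step_nth wx Pst Qst
        P_def[symmetric] Q_def[symmetric])
  ultimately show ?thesis
    using V P_sym unfolding vector_minus_component by linarith
qed

lemma Euler_step_almost_flow:
  "\<exists>K\<ge>0. \<forall>s u t y. S \<le> s \<and> s \<le> u \<and> u \<le> t \<and> t \<le> T \<longrightarrow>
    norm (\<mu> u t (\<mu> s u y) - \<mu> s t y) \<le> K * (h s t) ^ 3"
proof -
  define n where "n = real CARD('n)"
  \<comment> \<open>\<open>K1\<close> and \<open>K2\<close> belong to the remainders
    \<open>?R1\<close> and \<open>?R2\<close> of the composition formula, and \<open>2 * K3\<close>
    covers \<open>?R3 / 2\<close> and \<open>?R4\<close>. Each remainder is a product of total
    degree three in \<open>h\<close>.\<close>
  define K1 where "K1 = n * (L * Z\<^sup>2 * A)"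
  define K2 where "K2 = n * (real CARD('m) * (F * (2 * n\<^sup>2 * F * A)) * A)"
  define K3 where "K3 = n * (n * (L * Z * A))"
  have nonneg': "0 \<le> n" "0 \<le> K1" "0 \<le> K2" "0 \<le> K3"
    unfolding n_def K1_def K2_def K3_def using nonneg Z_nonneg by simp_all
  have "norm (\<mu> u t (\<mu> s u y) - \<mu> s t y) \<le> (real CARD('m) * (K1 + K2 + 2 * K3)) * (h s t) ^ 3"
    if st: "S \<le> s" "s \<le> u" "u \<le> t" "t \<le> T" for s u t y
  proof -
    define z where "z = \<mu> s u y"
    define h' where "h' = h s t"
    have h: "0 \<le> h s u" "h s u \<le> h'" "0 \<le> h u t" "h u t \<le> h'" "0 \<le> h'"
      unfolding h'_def using st by (auto intro!: h_nonneg h_mono)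
    have zy: "norm (z - y) \<le> Z * h'"
    proof -
      have "norm (z - y) \<le> Z * h s u"
        unfolding z_def using st by (intro Euler_step_increment) auto
      also have "\<dots> \<le> Z * h'"
        using h Z_nonneg by (intro mult_left_mono)
      finally show ?thesis .
    qed
    have w: "\<bar>X (Vertex b) u t\<bar> \<le> A * h'" for b
    proof -
      have "\<bar>X (Vertex b) u t\<bar> \<le> A * h u t"
        using st by (intro X_Vertex_bound) auto
      also have "\<dots> \<le> A * h'"
        using h nonneg by (intro mult_left_mono)
      finally show ?thesis .
    qed
    have sq: "A * (h u t)\<^sup>2 \<le> A * h'\<^sup>2" "(h s u)\<^sup>2 \<le> h'\<^sup>2"
      using h nonneg by (auto intro!: mult_left_mono power_mono)
    have W: "\<bar>X (Vertices (Upair a b)) u t\<bar> \<le> A * h'\<^sup>2" "\<bar>X (Ladder a b) u t\<bar> \<le> A * h'\<^sup>2" for a b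
      using X_Vertices_bound[of u t a b] X_Ladder_bound[of u t a b] sq(1) st by auto
    have fz: "\<bar>f i \<tau> z - f i \<tau> y\<bar> \<le> L * (Z * h')" for i \<tau>
      using f_Lipschitz[of i \<tau> z y] mult_left_mono[OF zy nonneg(2)] by linarith
    have R1: "\<bar>f i \<tau> z - f i \<tau> y - (\<Sum>j\<in>UNIV. partial_derivative j (f i \<tau>) y * (z $ j - y $ j))\<bar>
        \<le> L * (Z * h')\<^sup>2" for i \<tau>
      using f_Taylor[of i \<tau> z y] mult_left_mono[OF power_mono[OF zy norm_ge_zero, of 2] nonneg(2)]
      by linarith
    have R2: "\<bar>z $ j - y $ j - (\<Sum>a\<in>UNIV. f j (Vertex a) y * X (Vertex a) s u)\<bar>
        \<le> 2 * n\<^sup>2 * F * A * h'\<^sup>2" for j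
    proof -
      have "\<bar>z $ j - y $ j - (\<Sum>a\<in>UNIV. f j (Vertex a) y * X (Vertex a) s u)\<bar>
          \<le> 2 * n\<^sup>2 * F * A * (h s u)\<^sup>2"
        unfolding z_def n_def using st by (intro Euler_step_remainder) auto
      also have "\<dots> \<le> 2 * n\<^sup>2 * F * A * h'\<^sup>2"
        using sq(2) nonneg by (intro mult_left_mono) auto
      finally show ?thesis .
    qed
    have "\<bar>(\<mu> u t z - \<mu> s t y) $ i\<bar> \<le> (K1 + K2 + 2 * K3) * h' ^ 3" for i
    proof -
      let ?R1 = "\<Sum>b\<in>UNIV. (f i (Vertex b) z - f i (Vertex b) y
        - (\<Sum>j\<in>UNIV. partial_derivative j (f i (Vertex b)) y * (z $ j - y $ j))) * X (Vertex b) u t"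
      let ?R2 = "\<Sum>b\<in>UNIV. (\<Sum>j\<in>UNIV. partial_derivative j (f i (Vertex b)) y *
        (z $ j - y $ j - (\<Sum>a\<in>UNIV. f j (Vertex a) y * X (Vertex a) s u))) * X (Vertex b) u t"
      let ?R3 = "\<Sum>a\<in>UNIV. \<Sum>b\<in>UNIV. (f i (Vertices (Upair a b)) z - f i (Vertices (Upair a b)) y) *
        X (Vertices (Upair a b)) u t"
      let ?R4 = "\<Sum>a\<in>UNIV. \<Sum>b\<in>UNIV. (f i (Ladder a b) z - f i (Ladder a b) y) * X (Ladder a b) u t"
      have "norm ?R1 \<le> n * (L * (Z * h')\<^sup>2 * (A * h'))"
        unfolding n_def
        by (intro sum_norm_bound) (auto simp: abs_mult intro!: mult_mono R1 w mult_nonneg_nonneg nonneg)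
      then have r1: "\<bar>?R1\<bar> \<le> K1 * h' ^ 3"
        by (simp add: K1_def power2_eq_square power3_eq_cube mult_ac)
      have "norm (\<Sum>j\<in>UNIV. partial_derivative j (f i (Vertex b)) y *
          (z $ j - y $ j - (\<Sum>a\<in>UNIV. f j (Vertex a) y * X (Vertex a) s u)))
          \<le> real CARD('m) * (F * (2 * n\<^sup>2 * F * A * h'\<^sup>2))" for b
        by (intro sum_norm_bound) (auto simp: abs_mult intro!: mult_mono R2 df_bound nonneg)
      then have "norm ?R2 \<le> n * (real CARD('m) * (F * (2 * n\<^sup>2 * F * A * h'\<^sup>2)) * (A * h'))"
        unfolding n_def using nonneg
        by (intro sum_norm_bound) (auto simp: abs_mult intro!: mult_mono w mult_nonneg_nonneg)
      then have r2: "\<bar>?R2\<bar> \<le> K2 * h' ^ 3"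
        by (simp add: K2_def power2_eq_square power3_eq_cube mult_ac)
      have "norm ?R3 \<le> n * (n * (L * (Z * h') * (A * h'\<^sup>2)))"
        unfolding n_def using nonneg Z_nonneg h
        by (intro sum_norm_bound) (auto simp: abs_mult intro!: mult_mono W fz mult_nonneg_nonneg)
      then have r3: "\<bar>?R3\<bar> \<le> K3 * h' ^ 3"
        by (simp add: K3_def power2_eq_square power3_eq_cube mult_ac)
      have "norm ?R4 \<le> n * (n * (L * (Z * h') * (A * h'\<^sup>2)))"
        unfolding n_def using nonneg Z_nonneg h
        by (intro sum_norm_bound) (auto simp: abs_mult intro!: mult_mono W fz mult_nonneg_nonneg)
      then have r4: "\<bar>?R4\<bar> \<le> K3 * h' ^ 3"
        by (simp add: K3_def power2_eq_square power3_eq_cube mult_ac)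
      show ?thesis
        unfolding Euler_step_composition[OF st z_def] using r1 r2 r3 r4
        by (simp add: distrib_right)
    qed
    then show ?thesis
      unfolding z_def h'_def mult.assoc by (rule norm_le_CARD)
  qed
  moreover have "0 \<le> real CARD('m) * (K1 + K2 + 2 * K3)"
    using nonneg' by simp
  ultimately show ?thesis
    by (intro exI[of _ "real CARD('m) * (K1 + K2 + 2 * K3)"]) auto
qed

end

section \<open>Bounds for compactly supported rough velocity fields\<close>

text \<open>The sum of finitely many non-negative constants dominates each of them.\<close>

lemma uniform_constant:
  fixes P :: "'k::finite \<Rightarrow> real \<Rightarrow> bool"
  assumes "\<And>k. \<exists>M\<ge>0. P k M" and mono: "\<And>k M M'. \<lbrakk>P k M; M \<le> M'\<rbrakk> \<Longrightarrow> P k M'"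
  shows "\<exists>M\<ge>0. \<forall>k. P k M"
proof -
  obtain M where M: "\<And>k. 0 \<le> M k" "\<And>k. P k (M k)"
    using assms(1) by metis
  have "M k \<le> sum M UNIV" for k
    using M(1) by (intro member_le_sum) auto
  then have "\<forall>k. P k (sum M UNIV)"
    using M(2) mono by blast
  moreover have "0 \<le> sum M UNIV"
    using M(1) by (simp add: sum_nonneg)
  ultimately show ?thesis
    by blast
qed

text \<open>Links the Taylor estimate, which is about the Frechet derivative, with admissibility,
  which is about partial derivatives.\<close>

lemma frechet_derivative_eq_sum_partial_derivative:
  fixes g :: "real ^ 'm::finite \<Rightarrow> real"
  assumes "g differentiable (at y)"
  shows "frechet_derivative g (at y) v = (\<Sum>j\<in>UNIV. partial_derivative j g y * v $ j)"
proof -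
  have lin: "linear (frechet_derivative g (at y))"
    using assms by (rule linear_frechet_derivative)
  have "frechet_derivative g (at y) v = frechet_derivative g (at y) (\<Sum>j\<in>UNIV. (v $ j) *\<^sub>R axis j 1)"
    using basis_expansion[of v] by (simp add: scalar_mult_eq_scaleR)
  also have "\<dots> = (\<Sum>j\<in>UNIV. partial_derivative j g y * v $ j)"
    using lin by (simp add: linear_sum linear_cmul partial_derivative_def mult.commute)
  finally show ?thesis .
qed

lemma rough_velocity_field_bounds:
  fixes f :: "'m::finite \<Rightarrow> 'n::finite forest \<Rightarrow> real ^ 'm \<Rightarrow> real"
  assumes "rough_velocity_field f" "compact K" "\<And>i \<tau> y. y \<notin> K \<Longrightarrow> f i \<tau> y = 0"
  shows "\<exists>F\<ge>0. \<forall>i \<tau> y. \<bar>f i \<tau> y\<bar> \<le> F \<and> (\<forall>j. \<bar>partial_derivative j (f i \<tau>) y\<bar> \<le> F)"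
    and "\<exists>L\<ge>0. \<forall>i \<tau> y z. \<bar>f i \<tau> z - f i \<tau> y\<bar> \<le> L * norm (z - y) \<and>
      \<bar>f i \<tau> z - f i \<tau> y - (\<Sum>j\<in>UNIV. partial_derivative j (f i \<tau>) y * (z $ j - y $ j))\<bar>
        \<le> L * (norm (z - y))\<^sup>2"
proof -
  have C_k: "C_k k (f i \<tau>)" for k i \<tau>
    using assms(1) by (simp add: rough_velocity_field_def smooth_def)
  have diff: "f i \<tau> differentiable (at y)" for i \<tau> y
    using C_k[of 1 i \<tau>] by simp
  \<comment> \<open>Coordinate and forest are packed into one index \<open>k\<close> of a finite
    type, so that a single constant serves all of them.\<close>
  have "\<exists>M\<ge>0. \<forall>k. \<forall>y. \<bar>f (fst k) (snd k) y\<bar> \<le> M"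
  proof (rule uniform_constant)
    show "\<exists>M\<ge>0. \<forall>y. \<bar>f (fst k) (snd k) y\<bar> \<le> M" for k
      using C_k[of 0 "fst k" "snd k"] assms(2,3)
      by (intro bounded_if_zero_outside_compact[of _ K]) auto
  qed (meson order_trans)
  then obtain F1 where F1: "F1 \<ge> 0" "\<And>i \<tau> y. \<bar>f i \<tau> y\<bar> \<le> F1"
    by auto
  have "\<exists>M\<ge>0. \<forall>k. \<forall>y. \<bar>partial_derivative (fst k) (f (fst (snd k)) (snd (snd k))) y\<bar> \<le> M"
  proof (rule uniform_constant)
    fix k :: "'m \<times> 'm \<times> 'n forest"
    let ?f = "f (fst (snd k)) (snd (snd k))"
    show "\<exists>M\<ge>0. \<forall>y. \<bar>partial_derivative (fst k) ?f y\<bar> \<le> M"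
      unfolding partial_derivative_def
    proof (rule bounded_if_zero_outside_compact[OF _ assms(2)])
      show "continuous_on UNIV (\<lambda>y. frechet_derivative ?f (at y) (axis (fst k) 1))"
        using C_k[of 1 "fst (snd k)" "snd (snd k)"] by simp
      show "frechet_derivative ?f (at y) (axis (fst k) 1) = 0" if "y \<notin> K" for y
        by (subst frechet_derivative_zero_outside_closed[of K])
          (use assms(2,3) that compact_imp_closed in auto)
    qed
  qed (meson order_trans)
  then obtain F2 where F2: "F2 \<ge> 0" "\<And>i \<tau> j y. \<bar>partial_derivative j (f i \<tau>) y\<bar> \<le> F2"
    by auto
  show "\<exists>F\<ge>0. \<forall>i \<tau> y. \<bar>f i \<tau> y\<bar> \<le> F \<and> (\<forall>j. \<bar>partial_derivative j (f i \<tau>) y\<bar> \<le> F)"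
    using F1 F2 by (intro exI[of _ "max F1 F2"]) (auto simp: le_max_iff_disj)
  have "\<exists>M\<ge>0. \<forall>k. \<forall>y z. \<bar>f (fst k) (snd k) z - f (fst k) (snd k) y\<bar> \<le> M * norm (z - y)"
  proof (rule uniform_constant)
    show "\<exists>M\<ge>0. \<forall>y z. \<bar>f (fst k) (snd k) z - f (fst k) (snd k) y\<bar> \<le> M * norm (z - y)" for k
      using C_k assms(2,3) by (rule C_1_compact_support_Lipschitz)
  qed (meson mult_right_mono norm_ge_zero order_trans)
  then obtain L1 where L1: "L1 \<ge> 0" "\<And>i \<tau> y z. \<bar>f i \<tau> z - f i \<tau> y\<bar> \<le> L1 * norm (z - y)"
    by auto
  have "\<exists>M\<ge>0. \<forall>k. \<forall>y z. \<bar>f (fst k) (snd k) z - f (fst k) (snd k) y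
      - frechet_derivative (f (fst k) (snd k)) (at y) (z - y)\<bar> \<le> M * (norm (z - y))\<^sup>2"
  proof (rule uniform_constant)
    show "\<exists>M\<ge>0. \<forall>y z. \<bar>f (fst k) (snd k) z - f (fst k) (snd k) y
        - frechet_derivative (f (fst k) (snd k)) (at y) (z - y)\<bar> \<le> M * (norm (z - y))\<^sup>2" for k
      using C_k assms(2,3) by (rule C_2_compact_support_Taylor)
  qed (meson mult_right_mono zero_le_power2 order_trans)
  then obtain L2 where L2: "L2 \<ge> 0" "\<And>i \<tau> y z. \<bar>f i \<tau> z - f i \<tau> y
      - frechet_derivative (f i \<tau>) (at y) (z - y)\<bar> \<le> L2 * (norm (z - y))\<^sup>2"
    by auto
  have "\<bar>f i \<tau> z - f i \<tau> y\<bar> \<le> max L1 L2 * norm (z - y)" for i \<tau> y z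
    by (rule order_trans[OF L1(2)]) (simp add: mult_right_mono)
  moreover have "\<bar>f i \<tau> z - f i \<tau> y - (\<Sum>j\<in>UNIV. partial_derivative j (f i \<tau>) y * (z $ j - y $ j))\<bar>
      \<le> max L1 L2 * (norm (z - y))\<^sup>2" for i \<tau> y z
    by (rule order_trans[OF L2(2)[unfolded frechet_derivative_eq_sum_partial_derivative[OF diff] vector_minus_component]])
      (simp add: mult_right_mono)
  ultimately show "\<exists>L\<ge>0. \<forall>i \<tau> y z. \<bar>f i \<tau> z - f i \<tau> y\<bar> \<le> L * norm (z - y) \<and>
      \<bar>f i \<tau> z - f i \<tau> y - (\<Sum>j\<in>UNIV. partial_derivative j (f i \<tau>) y * (z $ j - y $ j))\<bar>
        \<le> L * (norm (z - y))\<^sup>2"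
    using L1(1) by (intro exI[of _ "max L1 L2"]) auto
qed

section \<open>Choice of the constants, the invariant ball, and pairs of times with large
  control\<close>

theorem theorem4p12:
  fixes S T p :: real
    and \<omega> :: "real \<Rightarrow> real \<Rightarrow> real"
    and X :: "'n::finite forest \<Rightarrow> real \<Rightarrow> real \<Rightarrow> real"
    and f :: "'m::finite \<Rightarrow> 'n forest \<Rightarrow> real ^ 'm \<Rightarrow> real"
    and Y0 :: "real ^ 'm"
  assumes "S \<le> T"
    and "1 \<le> p" and "p < 3"
    and "control_function S T \<omega>"
    and "branched_rough_path S T p \<omega> X"
    and "rough_velocity_field f"
    and "compactly_supported f"
    and "admissible f"
  shows "\<exists>Y :: real \<Rightarrow> real ^ 'm. Y S = Y0 \<and>
    (\<exists>C>0. \<forall>i s t. S \<le> s \<and> s \<le> t \<and> t \<le> T \<longrightarrow>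
      \<bar>Y t $ i - Y s $ i
        - (\<Sum>\<tau>\<in>UNIV. 1 / real (symmetry_factor \<tau>) * f i \<tau> (Y s) * X \<tau> s t)\<bar>
      \<le> C * \<omega> s t powr (3 / p))"
proof -
  define K where "K = closure {y. \<exists>i \<tau>. f i \<tau> y \<noteq> 0}"
  have K: "compact K"
    using assms(7) unfolding compactly_supported_def K_def .
  have f_zero: "f i \<tau> y = 0" if "y \<notin> K" for i \<tau> y
    using that closure_subset[of "{y. \<exists>i \<tau>. f i \<tau> y \<noteq> 0}"] unfolding K_def by blast
  obtain F where F: "F \<ge> 0" "\<And>i \<tau> y. \<bar>f i \<tau> y\<bar> \<le> F" "\<And>i \<tau> j y. \<bar>partial_derivative j (f i \<tau>) y\<bar> \<le> F"
    using rough_velocity_field_bounds(1)[OF assms(6) K f_zero] by blast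
  obtain L where L: "L \<ge> 0" "\<And>i \<tau> y z. \<bar>f i \<tau> z - f i \<tau> y\<bar> \<le> L * norm (z - y)"
    "\<And>i \<tau> y z. \<bar>f i \<tau> z - f i \<tau> y - (\<Sum>j\<in>UNIV. partial_derivative j (f i \<tau>) y * (z $ j - y $ j))\<bar>
        \<le> L * (norm (z - y))\<^sup>2"
    using rough_velocity_field_bounds(2)[OF assms(6) K f_zero] by blast
  have chen: "X (Vertex a) s t = X (Vertex a) s u + X (Vertex a) u t"
    "X (Vertices (Upair a b)) s t = X (Vertex a) s t * X (Vertex b) s t"
    "X (Ladder a b) s t = X (Ladder a b) s u + X (Ladder a b) u t + X (Vertex a) s u * X (Vertex b) u t"
    if "S \<le> s" "s \<le> u" "u \<le> t" "t \<le> T" for a b s u t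
    using assms(5) that unfolding branched_rough_path_def by blast+
  obtain A where "A > 0" and A: "\<And>a b s t. \<lbrakk>S \<le> s; s \<le> t; t \<le> T\<rbrakk> \<Longrightarrow>
        \<bar>X (Vertex a) s t\<bar> \<le> A * \<omega> s t powr (1 / p) \<and>
        \<bar>X (Vertices (Upair a b)) s t\<bar> \<le> A * \<omega> s t powr (2 / p) \<and>
        \<bar>X (Ladder a b) s t\<bar> \<le> A * \<omega> s t powr (2 / p)"
    using assms(5) unfolding branched_rough_path_def ordered_times_def by fast
  have \<omega>_nonneg: "0 \<le> \<omega> s t" if "S \<le> s" "s \<le> t" "t \<le> T" for s t
    using assms(4) that unfolding control_function_def ordered_times_def by blast
  have \<omega>_zero: "\<omega> s s = 0" if "s \<in> {S..T}" for s
    using assms(4) that unfolding control_function_def by blast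
  have \<omega>_add: "\<omega> s u + \<omega> u t \<le> \<omega> s t" if "S \<le> s" "s \<le> u" "u \<le> t" "t \<le> T" for s u t
    using assms(4) that unfolding control_function_def by blast
  have \<omega>_mono: "\<omega> u v \<le> \<omega> s t" if "S \<le> s" "s \<le> u" "u \<le> v" "v \<le> t" "t \<le> T" for s u v t
    using \<omega>_add[of s u t] \<omega>_add[of u v t] \<omega>_nonneg[of s u] \<omega>_nonneg[of v t] that by linarith
  define h where "h s t = \<omega> s t powr (1 / p)" for s t
  define H where "H = h S T"
  define \<theta> where "\<theta> = 3 / p"
  have \<theta>_nonneg: "0 \<le> \<theta>"
    unfolding \<theta>_def using \<open>1 \<le> p\<close> by simp
  have h_pow: "\<omega> s t powr (2 / p) = (h s t)\<^sup>2" "\<omega> s t powr \<theta> = (h s t) ^ 3" for s t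
    using powr_power[of "\<omega> s t" "1 / p"] by (cases "\<omega> s t = 0"; simp add: h_def \<theta>_def)+
  have h_mono: "h u v \<le> h s t" if "S \<le> s" "s \<le> u" "u \<le> v" "v \<le> t" "t \<le> T" for s u v t
    unfolding h_def using \<omega>_mono[OF that] \<omega>_nonneg[of u v] that \<open>1 \<le> p\<close> by (intro powr_mono2) auto
  interpret bounded_rough_equation S T f X h F L A H
  proof
    show "\<bar>X (Vertices (Upair a b)) s t\<bar> \<le> A * (h s t)\<^sup>2" "\<bar>X (Ladder a b) s t\<bar> \<le> A * (h s t)\<^sup>2"
      if "S \<le> s" "s \<le> t" "t \<le> T" for a b s t
      using A[OF that] unfolding h_pow by blast+
    show "\<bar>X (Vertex a) s t\<bar> \<le> A * h s t" if "S \<le> s" "s \<le> t" "t \<le> T" for a s t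
      using A[OF that] unfolding h_def by blast
    show "h s t \<le> H" if "S \<le> s" "s \<le> t" "t \<le> T" for s t
      unfolding H_def using that by (intro h_mono) auto
    show "0 \<le> H" "0 \<le> h s t" for s t
      by (simp_all add: H_def h_def)
    show "X (Vertices (Upair a b)) s t = X (Vertex a) s t * X (Vertex b) s t"
      if "S \<le> s" "s \<le> t" "t \<le> T" for a b s t
      \<comment> \<open>The product rule involves no intermediate time, so the degenerate choice
        \<open>u = s\<close> suffices.\<close>
      using that by (intro chen(2)[of s s t]) auto
    show "0 \<le> A"
      using \<open>A > 0\<close> by simp
  qed (fact F L assms(8) chen(1,3) h_mono)+
  obtain K' where K': "K' \<ge> 0" "\<And>s u t y. \<lbrakk>S \<le> s; s \<le> u; u \<le> t; t \<le> T\<rbrakk> \<Longrightarrow>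
      norm (\<mu> u t (\<mu> s u y) - \<mu> s t y) \<le> K' * (h s t) ^ 3"
    using Euler_step_almost_flow by blast
  define c where "c = real CARD('m) * (real CARD('n forest) * (A * (1 + H) * L))"
  have c: "0 \<le> c"
    unfolding c_def using nonneg by simp
  have "2 powr 1 < 2 powr \<theta>"
    using assms(2,3) unfolding \<theta>_def by (intro powr_less_mono) auto
  then have \<theta>2: "2 < 2 powr \<theta>"
    by simp
  \<comment> \<open>With this choice \<open>2 + c * \<epsilon>\<close> equals
    \<open>2 powr \<theta> - \<epsilon>\<close>, which gives the strict inequality needed for
    \<open>\<Lambda> = 1 + c * \<epsilon>\<close>. It is positive because \<open>p < 3\<close>. The
    threshold \<open>\<delta>\<close> below translates \<open>h \<le> \<epsilon>\<close> into a
    condition on \<open>\<omega>\<close>.\<close>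
  define \<epsilon> where "\<epsilon> = (2 powr \<theta> - 2) / (c + 1)"
  have \<epsilon>: "\<epsilon> > 0" "\<epsilon> * (c + 1) = 2 powr \<theta> - 2"
    unfolding \<epsilon>_def using c \<theta>2 by simp_all
  then have \<epsilon>_c: "1 + (1 + c * \<epsilon>) < 2 powr \<theta>"
    by (simp add: algebra_simps)
  define \<delta> where "\<delta> = \<epsilon> powr p"
  have \<delta>: "\<delta> > 0"
    using \<epsilon>(1) by (simp add: \<delta>_def)
  have h_small: "h s t \<le> \<epsilon>" if "S \<le> s" "s \<le> t" "t \<le> T" "\<omega> s t \<le> \<delta>" for s t
  proof -
    have "h s t \<le> \<delta> powr (1 / p)"
      unfolding h_def using that \<omega>_nonneg \<open>1 \<le> p\<close> by (intro powr_mono2) auto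
    also have "\<dots> = \<epsilon>"
      using \<epsilon>(1) \<open>1 \<le> p\<close> by (simp add: \<delta>_def powr_powr)
    finally show ?thesis .
  qed
  obtain R0 where R0: "\<And>y. y \<in> K \<Longrightarrow> norm y \<le> R0"
    using compact_imp_bounded[OF K] by (auto simp: bounded_iff)
  \<comment> \<open>The ball of radius \<open>R\<close> is invariant: off \<open>K\<close> a step is
    the identity, and from \<open>K\<close> it moves by at most \<open>Z * H\<close>. The maximum
    with \<open>norm Y0\<close> puts the initial value into the ball and keeps \<open>R\<close>
    non-negative even if \<open>K\<close> is empty and \<open>R0\<close> arbitrary.\<close>
  define R where "R = max (norm Y0) (R0 + Z * H)"
  have "\<exists>Y C. Y S = Y0 \<and> (\<forall>t. Y t \<in> cball 0 R) \<and> (\<forall>s t. S \<le> s \<and> s \<le> t \<and> t \<le> T \<and> \<omega> s t \<le> \<delta> \<longrightarrow>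
    norm (Y t - \<mu> s t (Y s)) \<le> C * \<omega> s t powr \<theta>)"
  proof (rule almost_flow_has_solution[where \<Lambda> = "1 + c * \<epsilon>" and K = K'])
    show "superadditive_on {S..T} \<omega>"
      unfolding superadditive_on_def using \<omega>_add by simp
    show "0 \<le> \<omega> s t" if "s \<in> {S..T}" "t \<in> {S..T}" "s \<le> t" for s t
      using that by (intro \<omega>_nonneg) auto
    show "\<mu> s s y = y" if "s \<in> {S..T}" for s y
      using that \<omega>_zero by (intro Euler_step_refl) (auto simp: h_def)
    show "norm (\<mu> s t z - \<mu> s t y) \<le> (1 + c * \<epsilon>) * norm (z - y)"
      if "s \<in> {S..T}" "t \<in> {S..T}" "s \<le> t" "\<omega> s t \<le> \<delta>" for s t y z
    proof -
      have "norm (\<mu> s t z - \<mu> s t y) \<le> (1 + c * h s t) * norm (z - y)"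
        using Euler_step_Lipschitz[of s t z y] that unfolding c_def by simp
      also have "\<dots> \<le> (1 + c * \<epsilon>) * norm (z - y)"
        using h_small[of s t] c that by (intro mult_right_mono add_left_mono mult_left_mono) auto
      finally show ?thesis .
    qed
    show "norm (\<mu> u t (\<mu> s u y) - \<mu> s t y) \<le> K' * \<omega> s t powr \<theta>"
      if "s \<in> {S..T}" "u \<in> {S..T}" "t \<in> {S..T}" "s \<le> u" "u \<le> t" for s u t y
      unfolding h_pow using that by (intro K'(2)) auto
    show "\<mu> s t y \<in> cball 0 R" if "s \<in> {S..T}" "t \<in> {S..T}" "s \<le> t" "y \<in> cball 0 R" for s t y
    proof (cases "y \<in> K")
      case True
      have "norm (\<mu> s t y - y) \<le> Z * h s t"
        using that by (intro Euler_step_increment) auto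
      also have "\<dots> \<le> Z * H"
        using that Z_nonneg h_le by (intro mult_left_mono) auto
      finally have "norm (\<mu> s t y) \<le> R0 + Z * H"
        using R0[OF True] norm_triangle_sub[of "\<mu> s t y" y] by linarith
      then show ?thesis
        by (simp add: R_def)
    next
      case False
      then have "\<mu> s t y = y"
        by (simp add: Euler_step_def f_zero)
      then show ?thesis
        using that by simp
    qed
    show "Y0 \<in> cball 0 R" "0 \<le> 1 + c * \<epsilon>"
      using c \<epsilon>(1) by (simp_all add: R_def)
  qed (use \<epsilon>_c \<theta>_nonneg K'(1) \<open>S \<le> T\<close> \<omega>_zero in simp_all)
  then obtain Y C where Y: "Y S = Y0" "\<And>t. norm (Y t) \<le> R"
    "\<And>s t. \<lbrakk>S \<le> s; s \<le> t; t \<le> T; \<omega> s t \<le> \<delta>\<rbrakk> \<Longrightarrow> norm (Y t - \<mu> s t (Y s)) \<le> C * \<omega> s t powr \<theta>"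
    by (metis mem_cball_0)
  \<comment> \<open>For control above \<open>\<delta>\<close> the error is at most
    \<open>2 * R + Z * H\<close>, by boundedness of \<open>Y\<close> and of the increments of steps;
    \<open>B\<close> is scaled so that this is at most
    \<open>B * \<omega> s t powr \<theta>\<close>.\<close>
  define B where "B = (2 * R + Z * H) / \<delta> powr \<theta>"
  have "0 \<le> R"
    using norm_ge_zero[of Y0] unfolding R_def by linarith
  then have B: "0 \<le> B" "B * \<delta> powr \<theta> = 2 * R + Z * H"
    unfolding B_def using Z_nonneg nonneg(4) \<delta> by simp_all
  \<comment> \<open>The sum covers both small and large control; \<open>max C 1\<close> makes it
    positive, as nothing is known about the sign of \<open>C\<close>.\<close>
  have bound: "norm (Y t - \<mu> s t (Y s)) \<le> (max C 1 + B) * \<omega> s t powr \<theta>"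
    if st: "S \<le> s" "s \<le> t" "t \<le> T" for s t
  proof (cases "\<omega> s t \<le> \<delta>")
    case True
    have "norm (Y t - \<mu> s t (Y s)) \<le> C * \<omega> s t powr \<theta>"
      using st True by (rule Y(3))
    also have "\<dots> \<le> (max C 1 + B) * \<omega> s t powr \<theta>"
      using B(1) by (intro mult_right_mono) (linarith, simp)
    finally show ?thesis .
  next
    case False
    have "norm (\<mu> s t (Y s) - Y s) \<le> Z * h s t"
      using st by (rule Euler_step_increment)
    also have "\<dots> \<le> Z * H"
      using st Z_nonneg h_le by (intro mult_left_mono) auto
    finally have "norm (Y t - \<mu> s t (Y s)) \<le> 2 * R + Z * H"
      using Y(2)[of s] Y(2)[of t] norm_triangle_ineq4[of "Y t" "Y s"]
        norm_triangle_ineq4[of "Y t - Y s" "\<mu> s t (Y s) - Y s"] by simp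
    also have "\<dots> \<le> B * \<omega> s t powr \<theta>"
      unfolding B(2)[symmetric] using B(1) \<delta> False \<theta>_nonneg
      by (intro mult_left_mono powr_mono2) auto
    also have "\<dots> \<le> (max C 1 + B) * \<omega> s t powr \<theta>"
      by (intro mult_right_mono) auto
    finally show ?thesis .
  qed
  have "\<bar>Y t $ i - Y s $ i - (\<Sum>\<tau>\<in>UNIV. 1 / real (symmetry_factor \<tau>) * f i \<tau> (Y s) * X \<tau> s t)\<bar>
      \<le> (max C 1 + B) * \<omega> s t powr (3 / p)" if "S \<le> s" "s \<le> t" "t \<le> T" for i s t
  proof -
    have "Y t $ i - Y s $ i - (\<Sum>\<tau>\<in>UNIV. 1 / real (symmetry_factor \<tau>) * f i \<tau> (Y s) * X \<tau> s t)
        = (Y t - \<mu> s t (Y s)) $ i"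
      by (simp add: Euler_step_def)
    then show ?thesis
      using component_le_norm_cart[of "Y t - \<mu> s t (Y s)" i] bound[OF that] unfolding \<theta>_def by linarith
  qed
  moreover have "max C 1 + B > 0"
    using B(1) by linarith
  ultimately show ?thesis
    using Y(1) by blast
qed

end
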